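(* Let $\Omega\subset\mathbb{R}^N$ be a bounded open set, $\varepsilon>0$, $\Gamma_\varepsilon=\{x\in\mathbb{R}^N\setminus\Omega:\operatorname{dist}(x,\partial\Omega)<\varepsilon\}$ and $F:\Gamma_\varepsilon\to\mathbb{R}$ a bounded continuous function. Then the Pay or Leave Tug-of-War game with step $\varepsilon$ and terminal payoff $F$ has a value $u=u_{\rm I}=u_{\rm II}$, and it satisfies $$u(x)=\min\left\{\frac12\left(\sup_{y\in B_\varepsilon(x)}u(y)+\inf_{y\in B_\varepsilon(x)}u(y)\right);\ \max\left\{0;\ \sup_{y\in B_\varepsilon(x)}u(y)-\varepsilon\right\}\right\}$$ for $x\in\Omega$, and $u(x)=F(x)$ for $x\in\Gamma_\varepsilon$.
   Context: $B_\varepsilon(x)$ is the open ball. The game (Pay or Leave Tug-of-War) with step $\varepsilon$ and payoff $F$: a token starts at $x_0\in\Omega$. At each turn, with token at $x_k\in\Omega$, Player II (the minimizer) either plays Tug-of-War (a fair coin is tossed and the winner moves the token to any $x_{k+1}\in B_\varepsilon(x_k)$) or passes the turn to Player I (the maximizer), who then either moves the token to any $x_{k+1}\in B_\varepsilon(x_k)$ paying $\varepsilon$, or ends the game immediately with no further payoff. Otherwise the game ends when the token first leaves $\Omega$, at a point of $\Gamma_\varepsilon$. Formally, strategies $S_{\rm I},S_{\rm II}$ are (measurable) functions of partial histories with $S(x_0,\dots,x_k)\in B_\varepsilon(x_k)$, and decision variables $\theta_{\rm I},\theta_{\rm II}$ are $\{0,1\}$-valued functions of partial histories: $\theta_{\rm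 II}=1$ means Player II passes, $\theta_{\rm I}=1$ means Player I ends the game if given the turn. The game ends at $x_k\in\Omega$ if $\theta_{\rm I}=\theta_{\rm II}=1$ there; otherwise the transition probability is $$\tfrac12(1-\theta_{\rm II})\big(\delta_{S_{\rm I}(x_0,\dots,x_k)}+\delta_{S_{\rm II}(x_0,\dots,x_k)}\big)+\theta_{\rm II}(1-\theta_{\rm I})\delta_{S_{\rm I}(x_0,\dots,x_k)},$$ with $\theta_{\rm I},\theta_{\rm II}$ evaluated at $(x_0,\dots,x_k)$. Let $\tau$ be the time at which the game ends and extend $F$ by $0$ in $\Omega$. The expected payoff is $$E(S_{\rm I},\theta_{\rm I},S_{\rm II},\theta_{\rm II})=\mathbb{E}^{x_0}\Big[F(x_\tau)-\varepsilon\sum_{k=0}^{\tau-1}\theta_{\rm II}(x_0,\dots,x_k)(1-\theta_{\rm I}(x_0,\dots,x_k))\Big].$$ The values of the game for the players are $u_{\rm I}(x_0)=\sup_{S_{\rm I},\theta_{\rm I}}\inf_{S_{\rm II},\theta_{\rm II}}E$ and $u_{\rm II}(x_0)=\inf_{S_{\rm II},\theta_{\rm II}}\sup_{S_{\rm I},\theta_{\rm I}}E$, where if the game does not end almost surely $E$ is set to $-\infty$ in $u_{\rm I}$ and $+\infty$ in $u_{\rm II}$; on $\Gamma_\varepsilon$ both equal $F$. The game has a value if $u_{\rm I}=u_{\rm II}$. *)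

theory Defs
  imports "HOL-Probability.Probability"
begin

definition outer_strip :: "'a::euclidean_space set \<Rightarrow> real \<Rightarrow> 'a set" where
  "outer_strip \<Omega> \<epsilon> = {x. x \<notin> \<Omega> \<and> infdist x (frontier \<Omega>) < \<epsilon>}"

text \<open>
  The partial history \<open>(x\<^sub>0, \<dots>, x\<^sub>k)\<close> is a point of \<open>histories k\<close>, that is, an extensional
  function on \<open>{0..<Suc k}\<close>.  A player's full strategy is a pair \<open>(S, \<theta>)\<close> of a movement
  strategy and a decision variable, both given for every length of the history; their values at
  time \<open>k\<close> are only ever taken at points of \<open>histories k\<close>.
\<close>

abbreviation histories :: "nat \<Rightarrow> (nat \<Rightarrow> 'a::euclidean_space) measure" where
  "histories k \<equiv> PiM {0..<Suc k} (\<lambda>_. borel)"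

type_synonym 'a strategy = "(nat \<Rightarrow> (nat \<Rightarrow> 'a) \<Rightarrow> 'a) \<times> (nat \<Rightarrow> (nat \<Rightarrow> 'a) \<Rightarrow> bool)"

definition strategies :: "real \<Rightarrow> 'a::euclidean_space strategy set" where
  "strategies \<epsilon> =
     {S. \<forall>k. S k \<in> borel_measurable (histories k) \<and>
             (\<forall>h\<in>space (histories k). S k h \<in> ball (h k) \<epsilon>)} \<times>
     {\<theta>. \<forall>k. \<theta> k \<in> histories k \<rightarrow>\<^sub>M count_space UNIV}"

text \<open>
  Below, \<open>p = (S\<^sub>I, \<theta>\<^sub>I)\<close> is played by Player I and \<open>q = (S\<^sub>I\<^sub>I, \<theta>\<^sub>I\<^sub>I)\<close> by Player II.
  \<open>stops \<Omega> p q k h\<close> says that the game is over at time \<open>k\<close>: the token is outside \<open>\<Omega>\<close>, or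
  Player II passes the turn and Player I ends the game.
\<close>

definition stops ::
    "'a set \<Rightarrow> 'a::euclidean_space strategy \<Rightarrow> 'a strategy \<Rightarrow> nat \<Rightarrow> (nat \<Rightarrow> 'a) \<Rightarrow> bool" where
  "stops \<Omega> p q k h \<longleftrightarrow> h k \<notin> \<Omega> \<or> snd p k h \<and> snd q k h"

text \<open>
  The transition probability from a history of length \<open>k + 1\<close>.  Where the game is over the token
  is kept in place, only in order that paths be infinite; the payoff does not look past that time.
  The last case is the fair coin toss, whose law is
  \<open>(\<delta>\<^bsub>S\<^sub>I(h)\<^esub> + \<delta>\<^bsub>S\<^sub>I\<^sub>I(h)\<^esub>) / 2\<close>.
\<close>

definition transition ::
    "'a set \<Rightarrow> 'a::euclidean_space strategy \<Rightarrow> 'a strategy \<Rightarrow> nat \<Rightarrow> (nat \<Rightarrow> 'a) \<Rightarrow> 'a measure" where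
  "transition \<Omega> p q k h =
     (if stops \<Omega> p q k h then return borel (h k)
      else if snd q k h then return borel (fst p k h)
      else distr (measure_pmf (bernoulli_pmf (1/2))) borel
             (\<lambda>heads. if heads then fst p k h else fst q k h))"

definition kernels ::
    "'a set \<Rightarrow> 'a::euclidean_space strategy \<Rightarrow> 'a strategy \<Rightarrow> 'a \<Rightarrow> nat \<Rightarrow> (nat \<Rightarrow> 'a) \<Rightarrow> 'a measure" where
  "kernels \<Omega> p q x\<^sub>0 n = (case n of 0 \<Rightarrow> \<lambda>_. return borel x\<^sub>0 | Suc k \<Rightarrow> transition \<Omega> p q k)"

text \<open>The law of the token's path, on the product space of all sequences (Ionescu-Tulcea).\<close>

definition path_measure ::
    "'a set \<Rightarrow> 'a::euclidean_space strategy \<Rightarrow> 'a strategy \<Rightarrow> 'a \<Rightarrow> (nat \<Rightarrow> 'a) measure" where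
  "path_measure \<Omega> p q x\<^sub>0 =
     projective_family.lim UNIV (Ionescu_Tulcea.CI (kernels \<Omega> p q x\<^sub>0) (\<lambda>_. borel)) (\<lambda>_. borel)"

definition ends_at ::
    "'a set \<Rightarrow> 'a::euclidean_space strategy \<Rightarrow> 'a strategy \<Rightarrow> (nat \<Rightarrow> 'a) \<Rightarrow> nat \<Rightarrow> bool" where
  "ends_at \<Omega> p q \<omega> k \<longleftrightarrow> stops \<Omega> p q k (restrict \<omega> {0..<Suc k})"

definition ends_almost_surely ::
    "'a set \<Rightarrow> 'a::euclidean_space strategy \<Rightarrow> 'a strategy \<Rightarrow> 'a \<Rightarrow> bool" where
  "ends_almost_surely \<Omega> p q x\<^sub>0 \<longleftrightarrow> (AE \<omega> in path_measure \<Omega> p q x\<^sub>0. \<exists>k. ends_at \<Omega> p q \<omega> k)"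

text \<open>Meaningful only on paths along which the game ends.\<close>

definition end_time ::
    "'a set \<Rightarrow> 'a::euclidean_space strategy \<Rightarrow> 'a strategy \<Rightarrow> (nat \<Rightarrow> 'a) \<Rightarrow> nat" where
  "end_time \<Omega> p q \<omega> = (LEAST k. ends_at \<Omega> p q \<omega> k)"

definition payoff ::
    "'a set \<Rightarrow> real \<Rightarrow> ('a \<Rightarrow> real) \<Rightarrow> 'a::euclidean_space strategy \<Rightarrow> 'a strategy \<Rightarrow> (nat \<Rightarrow> 'a) \<Rightarrow> real" where
  "payoff \<Omega> \<epsilon> F p q \<omega> =
     (let \<tau> = end_time \<Omega> p q \<omega> in
      (if \<omega> \<tau> \<in> outer_strip \<Omega> \<epsilon> then F (\<omega> \<tau>) else 0) -
      \<epsilon> * (\<Sum>k<\<tau>. of_bool (snd q k (restrict \<omega> {0..<Suc k})) *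
                    (1 - of_bool (snd p k (restrict \<omega> {0..<Suc k})))))"

text \<open>
  The payoff is bounded above when \<open>F\<close> is bounded, but it need not be integrable: the expected total
  amount paid by Player I may be infinite, and then the expectation is \<open>-\<infinity>\<close>.  The Bochner integral
  would silently return \<open>0\<close> in that case, hence the difference of two nonnegative integrals
  (the coercion \<open>ennreal\<close> sends negative reals to \<open>0\<close>).
\<close>

definition expected_payoff ::
    "'a set \<Rightarrow> real \<Rightarrow> ('a \<Rightarrow> real) \<Rightarrow> 'a::euclidean_space strategy \<Rightarrow> 'a strategy \<Rightarrow> 'a \<Rightarrow> ereal" where
  "expected_payoff \<Omega> \<epsilon> F p q x\<^sub>0 =
     enn2ereal (\<integral>\<^sup>+ \<omega>. ennreal (payoff \<Omega> \<epsilon> F p q \<omega>) \<partial>path_measure \<Omega> p q x\<^sub>0) -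
     enn2ereal (\<integral>\<^sup>+ \<omega>. ennreal (- payoff \<Omega> \<epsilon> F p q \<omega>) \<partial>path_measure \<Omega> p q x\<^sub>0)"

definition value_I :: "'a set \<Rightarrow> real \<Rightarrow> ('a \<Rightarrow> real) \<Rightarrow> 'a::euclidean_space \<Rightarrow> ereal" where
  "value_I \<Omega> \<epsilon> F x\<^sub>0 =
     (if x\<^sub>0 \<in> outer_strip \<Omega> \<epsilon> then ereal (F x\<^sub>0)
      else SUP p\<in>strategies \<epsilon>. INF q\<in>strategies \<epsilon>.
        if ends_almost_surely \<Omega> p q x\<^sub>0 then expected_payoff \<Omega> \<epsilon> F p q x\<^sub>0 else - \<infinity>)"

definition value_II :: "'a set \<Rightarrow> real \<Rightarrow> ('a \<Rightarrow> real) \<Rightarrow> 'a::euclidean_space \<Rightarrow> ereal" where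
  "value_II \<Omega> \<epsilon> F x\<^sub>0 =
     (if x\<^sub>0 \<in> outer_strip \<Omega> \<epsilon> then ereal (F x\<^sub>0)
      else INF q\<in>strategies \<epsilon>. SUP p\<in>strategies \<epsilon>.
        if ends_almost_surely \<Omega> p q x\<^sub>0 then expected_payoff \<Omega> \<epsilon> F p q x\<^sub>0 else \<infinity>)"

end

theory Submission
  imports Defs
begin

text \<open>
  Suprema over open balls are lower semicontinuous whatever the function, so a solution \<open>u\<close> of the
  dynamic programming equation given by the Knaster-Tarski theorem is automatically Borel, and
  Borel near-optimal moves can be selected from a countable set.  Any such \<open>u\<close> is the value.  Where
  \<open>u\<close> is too flat for a player to make progress, it is replaced by a function that descends by a
  small \<open>k\<close> per step towards the region where \<open>u\<close> is steep; as \<open>\<Omega>\<close> is bounded, this costs a bounded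
  multiple of \<open>k\<close>.  Composition with a concave quadratic then yields a potential near \<open>u\<close> (for Player
  II) or near \<open>-u\<close> (for Player I) that drops by a fixed \<open>c > 0\<close> in the mean at every turn.  Following it
  for a long time \<open>T\<close> and pulling in a constant direction afterwards, each player forces the game to
  end almost surely with the desired expected payoff; the drift before \<open>T\<close> pays for the loss of
  control after \<open>T\<close>.
\<close>

section \<open>The law of the path\<close>

text \<open>Near-optimal play for \<open>u\<close> itself fails twice. Infima over open balls need
  not be attained, so each move loses a little, and over an unbounded number of turns the losses add
  up; and where \<open>u\<close> is locally constant nothing drives the game to an end. A fixed drop
  per turn cures both: it absorbs the selection error and can be traded for a term that grows with
  time. Concavity produces such a drop only if a move changes the function by a definite amount,
  which is why flat regions must be repaired first. Payment is linear: a step that pays \<epsilon>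
  and changes \<open>u\<close> by exactly \<epsilon> is balanced, and no concavity is involved. A
  slope on the correct side of 1 turns this balance into a gain, and the correct side depends on who
  follows the potential. From time \<open>T\<close> on, the player following the potential also
  rules out payments alone: Player II by never passing, Player I by leaving whenever given the turn.
  Hence payoffs are bounded and the opponent cannot make the expectation infinite. As Player I works
  with \<open>-u\<close>, one supermartingale argument with a sign \<sigma> serves both
  players.\<close>

lemma transition_measurable:
  fixes \<Omega> :: "'a::euclidean_space set"
  assumes "\<Omega> \<in> sets borel" and p: "p \<in> strategies \<epsilon>" and q: "q \<in> strategies \<epsilon>"
  shows "Measurable.pred (histories k) (stops \<Omega> p q k)"
    and "transition \<Omega> p q k \<in> histories k \<rightarrow>\<^sub>M subprob_algebra borel"
proof -
  have [measurable]: "\<Omega> \<in> sets borel" by fact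
  have [measurable]: "fst p k \<in> borel_measurable (histories k)" "fst q k \<in> borel_measurable (histories k)"
    "Measurable.pred (histories k) (snd p k)" "Measurable.pred (histories k) (snd q k)"
    using p q by (auto simp: strategies_def)
  show [measurable]: "Measurable.pred (histories k) (stops \<Omega> p q k)"
    unfolding stops_def by measurable
  have [measurable]: "(\<lambda>h. distr (measure_pmf (bernoulli_pmf (1/2))) borel
             (\<lambda>heads. if heads then fst p k h else fst q k h)) \<in> histories k \<rightarrow>\<^sub>M subprob_algebra borel"
  proof (rule measurable_distr2)
    show "(\<lambda>_. measure_pmf (bernoulli_pmf (1/2))) \<in> histories k \<rightarrow>\<^sub>M subprob_algebra (count_space UNIV)"
      by (intro measurable_const) (auto simp: space_subprob_algebra intro!: prob_space_imp_subprob_space measure_pmf.prob_space_axioms)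
  qed measurable
  show "transition \<Omega> p q k \<in> histories k \<rightarrow>\<^sub>M subprob_algebra borel"
    unfolding transition_def by measurable
qed

lemma Ionescu_Tulcea_kernels:
  assumes "\<Omega> \<in> sets borel" "p \<in> strategies \<epsilon>" "q \<in> strategies \<epsilon>"
  shows "Ionescu_Tulcea (kernels \<Omega> p q x\<^sub>0) (\<lambda>_. borel)"
proof (rule Ionescu_Tulcea.intro)
  show "kernels \<Omega> p q x\<^sub>0 i \<in> PiM {0..<i} (\<lambda>_. borel) \<rightarrow>\<^sub>M subprob_algebra borel" for i
    using transition_measurable[OF assms]
    by (cases i) (auto simp: kernels_def space_subprob_algebra intro!: measurable_const subprob_space_return)
  show "prob_space (kernels \<Omega> p q x\<^sub>0 i x)" if "x \<in> space (PiM {0..<i} (\<lambda>_. borel))" for i x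
    by (cases i)
       (auto simp: kernels_def transition_def
             intro!: prob_space_return prob_space.prob_space_distr measure_pmf.prob_space_axioms)
qed

text \<open>A history is an extensional function, hence also a point of the full sequence space,
  \<open>undefined\<close> beyond its end. Each missing coordinate is constant, so the inclusion is
  measurable, and one function on sequences can be integrated against path laws and history laws
  alike.\<close>

lemma measurable_extensional_PiM:
  "(\<lambda>h. h) \<in> PiM J (\<lambda>_. borel :: 'a::topological_space measure) \<rightarrow>\<^sub>M PiM UNIV (\<lambda>_. borel)"
proof (rule measurable_abs_UNIV)
  fix i
  show "(\<lambda>h. h i) \<in> PiM J (\<lambda>_. borel :: 'a measure) \<rightarrow>\<^sub>M borel"
  proof (cases "i \<in> J")
    case False
    then have "(\<lambda>h. undefined) \<in> PiM J (\<lambda>_. borel :: 'a measure) \<rightarrow>\<^sub>M (borel :: 'a measure) \<longleftrightarrow> ?thesis"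
      by (intro measurable_cong) (auto simp: space_PiM PiE_def extensional_def)
    moreover have "(\<lambda>h. undefined) \<in> PiM J (\<lambda>_. borel :: 'a measure) \<rightarrow>\<^sub>M (borel :: 'a measure)"
      by (rule measurable_const) simp
    ultimately show ?thesis by blast
  qed simp
qed

context
  fixes \<Omega> :: "'a::euclidean_space set" and p q :: "'a strategy" and \<epsilon> :: real and x\<^sub>0 :: 'a
  assumes \<Omega>: "\<Omega> \<in> sets borel" and p: "p \<in> strategies \<epsilon>" and q: "q \<in> strategies \<epsilon>"
begin

interpretation IT: Ionescu_Tulcea "kernels \<Omega> p q x\<^sub>0" "\<lambda>_. borel"
  by (rule Ionescu_Tulcea_kernels[OF \<Omega> p q])

lemma sets_path_measure: "sets (path_measure \<Omega> p q x\<^sub>0) = sets (PiM UNIV (\<lambda>_. borel))"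
  by (simp add: path_measure_def)

lemma space_path_measure: "space (path_measure \<Omega> p q x\<^sub>0) = UNIV"
  by (simp add: path_measure_def space_PiM PiE_def)

lemma distr_path_measure:
  "distr (path_measure \<Omega> p q x\<^sub>0) (PiM {0..<n} (\<lambda>_. borel)) (\<lambda>\<omega>. restrict \<omega> {0..<n})
     = IT.C 0 n (\<lambda>_. undefined)"
proof -
  have s: "(\<lambda>_. undefined) \<in> space (Pi\<^sub>M {0..<0} (\<lambda>_::nat. borel :: 'a measure))"
    by (simp add: space_PiM)
  have "IT.up_to {0..<n} \<le> n" by (simp add: IT.up_to_iff)
  \<comment> \<open>\<open>CI\<close> builds the marginal from the shortest initial segment
    containing the index set; for \<open>{0..<n}\<close> that segment is the set itself.\<close>
  have eq: "IT.up_to {0..<n} = n"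
  proof (cases n)
    case (Suc m)
    then have "m < IT.up_to {0..<n}" by (intro IT.up_to_less) auto
    with Suc \<open>_ \<le> n\<close> show ?thesis by simp
  qed (use \<open>_ \<le> n\<close> in simp)
  show ?thesis
    unfolding path_measure_def IT.distr_lim[OF finite_atLeastLessThan] IT.CI_def eq
    using IT.distr_C[OF order_refl s, of n] by simp
qed

lemma prob_space_path_measure: "prob_space (path_measure \<Omega> p q x\<^sub>0)"
proof
  have s: "(\<lambda>_. undefined) \<in> space (Pi\<^sub>M {0..<0} (\<lambda>_::nat. borel :: 'a measure))"
    by (simp add: space_PiM)
  have m: "(\<lambda>\<omega>. restrict \<omega> {0..<0}) \<in> path_measure \<Omega> p q x\<^sub>0 \<rightarrow>\<^sub>M PiM {0..<0} (\<lambda>_. borel)"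
    unfolding measurable_cong_sets[OF sets_path_measure refl] by measurable
  have "emeasure (path_measure \<Omega> p q x\<^sub>0) ((\<lambda>\<omega>. restrict \<omega> {0..<0}) -` space (PiM {0..<0} (\<lambda>_. borel :: 'a measure))
      \<inter> space (path_measure \<Omega> p q x\<^sub>0))
    = emeasure (IT.C 0 0 (\<lambda>_. undefined)) (space (IT.C 0 0 (\<lambda>_. undefined)))"
    unfolding distr_path_measure[symmetric] by (subst emeasure_distr[OF m]) simp_all
  also have "\<dots> = 1"
    using IT.prob_space_C[OF s, of 0, THEN prob_space.emeasure_space_1] .
  finally show "emeasure (path_measure \<Omega> p q x\<^sub>0) (space (path_measure \<Omega> p q x\<^sub>0)) = 1"
    by (simp add: space_path_measure space_PiM vimage_def restrict_def)
qed

text \<open>The condition \<open>loc\<close> says that \<open>f\<close> sees only the first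
  \<open>n\<close> coordinates, so the integral is one over the finite-dimensional marginal.\<close>

lemma nn_integral_path_measure:
  fixes f :: "(nat \<Rightarrow> 'a) \<Rightarrow> ennreal"
  assumes f: "f \<in> borel_measurable (PiM UNIV (\<lambda>_. borel))"
    and loc: "\<And>\<omega>. f (restrict \<omega> {0..<n}) = f \<omega>"
  shows "(\<integral>\<^sup>+\<omega>. f \<omega> \<partial>path_measure \<Omega> p q x\<^sub>0) = (\<integral>\<^sup>+h. f h \<partial>IT.C 0 n (\<lambda>_. undefined))"
proof -
  have m: "(\<lambda>\<omega>. restrict \<omega> {0..<n}) \<in> path_measure \<Omega> p q x\<^sub>0 \<rightarrow>\<^sub>M PiM {0..<n} (\<lambda>_. borel)"
    unfolding measurable_cong_sets[OF sets_path_measure refl] by measurable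
  show ?thesis
    unfolding distr_path_measure[symmetric]
    by (subst nn_integral_distr[OF m])
       (use measurable_compose[OF measurable_extensional_PiM f] loc in auto)
qed

lemma nn_integral_path_measure_0:
  fixes f :: "(nat \<Rightarrow> 'a) \<Rightarrow> ennreal"
  assumes f: "f \<in> borel_measurable (PiM UNIV (\<lambda>_. borel))"
    and loc: "\<And>\<omega>. f (restrict \<omega> {0..<Suc 0}) = f \<omega>"
  shows "(\<integral>\<^sup>+\<omega>. f \<omega> \<partial>path_measure \<Omega> p q x\<^sub>0) = f (\<lambda>_. x\<^sub>0)"
proof -
  have s: "(\<lambda>_. undefined) \<in> space (Pi\<^sub>M {0..<0} (\<lambda>_::nat. borel :: 'a measure))"
    by (simp add: space_PiM)
  have f': "f \<in> borel_measurable (PiM {0..<Suc 0} (\<lambda>_. borel))"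
    using measurable_compose[OF measurable_extensional_PiM f] .
  have "(\<integral>\<^sup>+\<omega>. f \<omega> \<partial>path_measure \<Omega> p q x\<^sub>0) = (\<integral>\<^sup>+h. f h \<partial>IT.C 0 (Suc 0) (\<lambda>_. undefined))"
    by (rule nn_integral_path_measure[OF f loc])
  also have "\<dots> = (\<integral>\<^sup>+h. f h \<partial>IT.eP 0 (\<lambda>_. undefined))"
    using bind_return[OF IT.measurable_eP s] by simp
  also have "\<dots> = (\<integral>\<^sup>+x. f ((\<lambda>_. undefined)(0 := x)) \<partial>return borel x\<^sub>0)"
    by (subst IT.nn_integral_eP[OF s f']) (simp add: kernels_def)
  also have "\<dots> = f ((\<lambda>_. undefined)(0 := x\<^sub>0))"
  proof (rule nn_integral_return)
    have "(\<lambda>x::'a. (\<lambda>_::nat. undefined)(0 := x)) \<in> borel \<rightarrow>\<^sub>M PiM UNIV (\<lambda>_. borel)"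
      by (rule measurable_abs_UNIV) simp
    from measurable_compose[OF this f] show "(\<lambda>x. f ((\<lambda>_. undefined)(0 := x))) \<in> borel_measurable borel" .
  qed simp
  also have "\<dots> = f (\<lambda>_. x\<^sub>0)"
  proof -
    have "restrict (\<lambda>_. x\<^sub>0) {0..<Suc 0} = (\<lambda>_. undefined)(0 := x\<^sub>0)" by (auto simp: restrict_def)
    with loc[of "\<lambda>_. x\<^sub>0"] show ?thesis by simp
  qed
  finally show ?thesis .
qed

text \<open>One step of a supermartingale argument in integrated form: the law of longer histories
  is the old law bound with the transition kernel, so a pointwise kernel inequality integrates
  without conditional expectations.\<close>

lemma nn_integral_path_measure_Suc:
  fixes f g :: "(nat \<Rightarrow> 'a) \<Rightarrow> ennreal"
  assumes f: "f \<in> borel_measurable (PiM UNIV (\<lambda>_. borel))"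
    and f_loc: "\<And>\<omega>. f (restrict \<omega> {0..<Suc (Suc n)}) = f \<omega>"
    and g: "g \<in> borel_measurable (PiM UNIV (\<lambda>_. borel))"
    and g_loc: "\<And>\<omega>. g (restrict \<omega> {0..<Suc n}) = g \<omega>"
    and le: "\<And>h. h \<in> space (histories n) \<Longrightarrow>
      (\<integral>\<^sup>+y. f (h(Suc n := y)) \<partial>transition \<Omega> p q n h) \<le> g h"
  shows "(\<integral>\<^sup>+\<omega>. f \<omega> \<partial>path_measure \<Omega> p q x\<^sub>0) \<le> (\<integral>\<^sup>+\<omega>. g \<omega> \<partial>path_measure \<Omega> p q x\<^sub>0)"
proof -
  have s: "(\<lambda>_. undefined) \<in> space (Pi\<^sub>M {0..<0} (\<lambda>_::nat. borel :: 'a measure))"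
    by (simp add: space_PiM)
  have f': "f \<in> borel_measurable (PiM {0..<Suc (Suc n)} (\<lambda>_. borel))"
    using measurable_compose[OF measurable_extensional_PiM f] .
  have N: "IT.eP (Suc n) \<in> IT.C 0 (Suc n) (\<lambda>_. undefined) \<rightarrow>\<^sub>M subprob_algebra (histories (Suc n))"
    unfolding measurable_cong_sets[OF IT.sets_C[OF s] refl] using IT.measurable_eP[of "Suc n"] by simp
  have "(\<integral>\<^sup>+\<omega>. f \<omega> \<partial>path_measure \<Omega> p q x\<^sub>0) = (\<integral>\<^sup>+h. f h \<partial>(IT.C 0 (Suc n) (\<lambda>_. undefined) \<bind> IT.eP (Suc n)))"
    by (subst nn_integral_path_measure[OF f f_loc]) simp
  also have "\<dots> = (\<integral>\<^sup>+h. \<integral>\<^sup>+y. f y \<partial>IT.eP (Suc n) h \<partial>IT.C 0 (Suc n) (\<lambda>_. undefined))"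
    by (rule nn_integral_bind[OF f' N])
  also have "\<dots> \<le> (\<integral>\<^sup>+h. g h \<partial>IT.C 0 (Suc n) (\<lambda>_. undefined))"
  proof (rule nn_integral_mono)
    fix h assume "h \<in> space (IT.C 0 (Suc n) (\<lambda>_. undefined))"
    then have h: "h \<in> space (histories n)" using IT.space_C[OF s, of "Suc n"] by (simp del: IT.C.simps)
    show "(\<integral>\<^sup>+y. f y \<partial>IT.eP (Suc n) h) \<le> g h"
      by (subst IT.nn_integral_eP[OF h f']) (use le[OF h] in \<open>simp add: kernels_def\<close>)
  qed
  also have "\<dots> = (\<integral>\<^sup>+\<omega>. g \<omega> \<partial>path_measure \<Omega> p q x\<^sub>0)"
    by (rule nn_integral_path_measure[OF g g_loc, symmetric])
  finally show ?thesis .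
qed

end

section \<open>Ending, payments and payoff as measurable, adapted functions of the path\<close>

lemma restrict_eq_mono:
  assumes "restrict \<omega> {0..<Suc n} = restrict \<omega>' {0..<Suc n}" "k \<le> n"
  shows "restrict \<omega> {0..<Suc k} = restrict \<omega>' {0..<Suc k}" and "\<omega> k = \<omega>' k"
proof -
  have eq: "restrict \<omega> {0..<Suc k} = restrict (restrict \<omega> {0..<Suc n}) {0..<Suc k}" for \<omega> :: "nat \<Rightarrow> 'a"
    using \<open>k \<le> n\<close> by (auto simp: restrict_def)
  show "restrict \<omega> {0..<Suc k} = restrict \<omega>' {0..<Suc k}"
    unfolding eq[of \<omega>] eq[of \<omega>'] assms(1) ..
  from fun_cong[OF this, of k] show "\<omega> k = \<omega>' k" by (simp add: restrict_def)
qed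

lemma end_time_eqI:
  "ends_at \<Omega> p q \<omega> k \<Longrightarrow> (\<And>j. j < k \<Longrightarrow> \<not> ends_at \<Omega> p q \<omega> j) \<Longrightarrow> end_time \<Omega> p q \<omega> = k"
  unfolding end_time_def by (rule Least_equality) (auto simp: not_less[symmetric])

text \<open>The bound \<open>T\<close> on the times of payment keeps every expectation below finite.\<close>

locale bounded_play =
  fixes \<Omega> :: "'a::euclidean_space set" and p q :: "'a strategy" and \<epsilon> :: real
    and F :: "'a \<Rightarrow> real" and K :: real and T :: nat
  assumes \<Omega>: "\<Omega> \<in> sets borel" and p: "p \<in> strategies \<epsilon>" and q: "q \<in> strategies \<epsilon>"
    and \<epsilon>: "0 < \<epsilon>"
    and F: "(\<lambda>x. if x \<in> outer_strip \<Omega> \<epsilon> then F x else 0) \<in> borel_measurable borel"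
    and F_le: "\<And>x. x \<in> outer_strip \<Omega> \<epsilon> \<Longrightarrow> \<bar>F x\<bar> \<le> K"
    and K: "0 \<le> K"
    and pays: "\<And>n h. h \<in> space (histories n) \<Longrightarrow> snd q n h \<Longrightarrow> \<not> snd p n h \<Longrightarrow> n < T"
begin

definition pay :: "nat \<Rightarrow> (nat \<Rightarrow> 'a) \<Rightarrow> real" where
  "pay k \<omega> = of_bool (snd q k (restrict \<omega> {0..<Suc k})) * (1 - of_bool (snd p k (restrict \<omega> {0..<Suc k})))"

definition cost :: "nat \<Rightarrow> (nat \<Rightarrow> 'a) \<Rightarrow> real" where
  "cost n \<omega> = (\<Sum>k<n. pay k \<omega>)"

definition ended :: "nat \<Rightarrow> (nat \<Rightarrow> 'a) \<Rightarrow> bool" where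
  "ended n \<omega> \<longleftrightarrow> (\<exists>k\<le>n. ends_at \<Omega> p q \<omega> k)"

abbreviation "paths \<equiv> PiM UNIV (\<lambda>_::nat. borel :: 'a measure)"

abbreviation "pf \<equiv> payoff \<Omega> \<epsilon> F p q"

lemma restrict_histories: "restrict \<omega> {0..<Suc k} \<in> space (histories k)"
  by (simp add: space_PiM)

lemma pay_bounds: "0 \<le> pay k \<omega>" "pay k \<omega> \<le> of_bool (k < T)"
  using pays[OF restrict_histories, of k \<omega>] by (auto simp: pay_def)

lemma cost_bounds: "0 \<le> cost n \<omega>" "cost n \<omega> \<le> real T"
proof -
  show "0 \<le> cost n \<omega>" by (simp add: cost_def sum_nonneg pay_bounds)
  have "cost n \<omega> \<le> (\<Sum>k<n. of_bool (k < T))"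
    unfolding cost_def by (intro sum_mono pay_bounds)
  also have "\<dots> = real (card ({..<n} \<inter> {..<T}))"
    by (simp add: sum.If_cases of_bool_def lessThan_def)
  also have "\<dots> \<le> real T"
    using card_mono[of "{..<T}" "{..<n} \<inter> {..<T}"] by simp
  finally show "cost n \<omega> \<le> real T" .
qed

lemma cost_bounds': "0 \<le> \<epsilon> * cost n \<omega>" "\<epsilon> * cost n \<omega> \<le> \<epsilon> * T"
  using cost_bounds[of n \<omega>] \<epsilon> by auto

lemma payoff_eq:
  "pf \<omega> = (if \<omega> (end_time \<Omega> p q \<omega>) \<in> outer_strip \<Omega> \<epsilon> then F (\<omega> (end_time \<Omega> p q \<omega>)) else 0)
     - \<epsilon> * cost (end_time \<Omega> p q \<omega>) \<omega>"
  by (simp add: payoff_def Let_def cost_def pay_def)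

lemma payoff_bounded: "\<bar>pf \<omega>\<bar> \<le> K + \<epsilon> * T"
  using cost_bounds'[of "end_time \<Omega> p q \<omega>" \<omega>] F_le[of "\<omega> (end_time \<Omega> p q \<omega>)"] K
  unfolding payoff_eq by auto

lemma measurable_snd [measurable]:
  "Measurable.pred (histories k) (snd p k)" "Measurable.pred (histories k) (snd q k)"
  using p q by (auto simp: strategies_def)

lemma measurable_restrict_paths [measurable]:
  "(\<lambda>\<omega>. restrict \<omega> {0..<Suc k}) \<in> paths \<rightarrow>\<^sub>M histories k"
  by measurable

lemma measurable_ends_at [measurable]: "Measurable.pred paths (\<lambda>\<omega>. ends_at \<Omega> p q \<omega> k)"
  unfolding ends_at_def
  by (rule measurable_compose[OF measurable_restrict_paths transition_measurable(1)[OF \<Omega> p q]])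

lemma measurable_ended [measurable]: "Measurable.pred paths (ended n)"
  unfolding ended_def by measurable

lemma measurable_pay [measurable]: "pay k \<in> borel_measurable paths"
proof -
  have [measurable]: "Measurable.pred paths (\<lambda>\<omega>. snd p k (restrict \<omega> {0..<Suc k}))"
    "Measurable.pred paths (\<lambda>\<omega>. snd q k (restrict \<omega> {0..<Suc k}))"
    by (rule measurable_compose[OF measurable_restrict_paths measurable_snd(1)],
        rule measurable_compose[OF measurable_restrict_paths measurable_snd(2)])
  show ?thesis unfolding pay_def of_bool_def by measurable
qed

lemma measurable_cost [measurable]: "cost n \<in> borel_measurable paths"
  unfolding cost_def by measurable

lemma measurable_payoff [measurable]: "pf \<in> borel_measurable paths"
proof -
  have [measurable]: "(\<lambda>\<omega>. if \<omega> i \<in> outer_strip \<Omega> \<epsilon> then F (\<omega> i) else 0) \<in> borel_measurable paths" for i :: nat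
    by (rule measurable_compose[OF _ F]) simp
  have [measurable]: "end_time \<Omega> p q \<in> paths \<rightarrow>\<^sub>M count_space UNIV"
    unfolding end_time_def by measurable
  \<comment> \<open>The payoff is read off at a random index; as this index is a natural number,
    countably many measurable pieces are glued together.\<close>
  have "(\<lambda>\<omega>. (\<lambda>i \<omega>. (if \<omega> i \<in> outer_strip \<Omega> \<epsilon> then F (\<omega> i) else 0) - \<epsilon> * cost i \<omega>)
     (end_time \<Omega> p q \<omega>) \<omega>) \<in> borel_measurable paths"
    by (rule measurable_compose_countable) measurable
  then show ?thesis unfolding payoff_eq .
qed

text \<open>This and the congruences below replace a filtration: a quantity is known at time
  \<open>n\<close> if it agrees on paths with the same first \<open>n + 1\<close> entries.\<close>

lemma ends_at_cong:
  assumes "restrict \<omega> {0..<Suc n} = restrict \<omega>' {0..<Suc n}" "k \<le> n"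
  shows "ends_at \<Omega> p q \<omega> k \<longleftrightarrow> ends_at \<Omega> p q \<omega>' k"
  using restrict_eq_mono(1)[OF assms] by (simp add: ends_at_def)

lemma ended_cong:
  assumes "restrict \<omega> {0..<Suc n} = restrict \<omega>' {0..<Suc n}"
  shows "ended n \<omega> \<longleftrightarrow> ended n \<omega>'"
  using ends_at_cong[OF assms] by (auto simp: ended_def)

lemma pay_cong:
  assumes "restrict \<omega> {0..<Suc n} = restrict \<omega>' {0..<Suc n}" "k \<le> n"
  shows "pay k \<omega> = pay k \<omega>'"
  using restrict_eq_mono(1)[OF assms] by (simp add: pay_def)

text \<open>The range extends to \<open>Suc n\<close> because \<open>cost k\<close> counts only
  turns before \<open>k\<close>.\<close>

lemma cost_cong:
  assumes "restrict \<omega> {0..<Suc n} = restrict \<omega>' {0..<Suc n}" "k \<le> Suc n"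
  shows "cost k \<omega> = cost k \<omega>'"
  unfolding cost_def by (intro sum.cong refl pay_cong[OF assms(1)]) (use assms(2) in auto)

lemma end_time_le: "ended n \<omega> \<Longrightarrow> end_time \<Omega> p q \<omega> \<le> n"
  by (auto simp: ended_def end_time_def intro: Least_le order_trans)

lemma end_time_cong:
  assumes eq: "restrict \<omega> {0..<Suc n} = restrict \<omega>' {0..<Suc n}" and "ended n \<omega>"
  shows "end_time \<Omega> p q \<omega>' = end_time \<Omega> p q \<omega>"
proof (rule end_time_eqI)
  have le: "end_time \<Omega> p q \<omega> \<le> n" using assms(2) by (rule end_time_le)
  have "ends_at \<Omega> p q \<omega> (end_time \<Omega> p q \<omega>)"
    using assms(2) unfolding end_time_def ended_def by (auto intro: LeastI)
  then show "ends_at \<Omega> p q \<omega>' (end_time \<Omega> p q \<omega>)" using ends_at_cong[OF eq le] by simp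
  fix j assume j: "j < end_time \<Omega> p q \<omega>"
  then have "\<not> ends_at \<Omega> p q \<omega> j" unfolding end_time_def by (rule not_less_Least)
  then show "\<not> ends_at \<Omega> p q \<omega>' j" using ends_at_cong[OF eq, of j] le j by simp
qed

lemma payoff_cong:
  assumes eq: "restrict \<omega> {0..<Suc n} = restrict \<omega>' {0..<Suc n}" and "ended n \<omega>"
  shows "pf \<omega> = pf \<omega>'"
proof -
  have "end_time \<Omega> p q \<omega> \<le> n" using assms(2) by (rule end_time_le)
  then show ?thesis
    using restrict_eq_mono(2)[OF eq, of "end_time \<Omega> p q \<omega>"] cost_cong[OF eq, of "end_time \<Omega> p q \<omega>"]
    unfolding payoff_eq end_time_cong[OF assms] by simp
qed

end

section \<open>Potentials bound the expected payoff\<close>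

lemma ennreal_mean:
  "0 \<le> r \<Longrightarrow> 0 \<le> s \<Longrightarrow> ennreal r * ennreal (1/2) + ennreal s * ennreal (1/2) = ennreal ((r + s) / 2)"
proof -
  assume "0 \<le> r" "0 \<le> s"
  then have "ennreal (r * (1/2) + s * (1/2)) = ennreal r * ennreal (1/2) + ennreal s * ennreal (1/2)"
    using ennreal_mult[of r "1/2"] ennreal_mult[of s "1/2"] by (subst ennreal_plus) auto
  moreover have "r * (1/2) + s * (1/2) = (r + s) / 2" by simp
  ultimately show ?thesis by metis
qed

text \<open>
  A potential \<open>W\<close> that does not increase in the mean along the play and dominates the payoff
  \<open>\<sigma>\<close> times that of Player I, with \<open>\<sigma> = 1\<close> when Player II follows the potential and \<open>\<sigma> = -1\<close> when
  Player I does.  Its growth on \<open>\<Omega>\<close> as time passes forces the game to end.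
\<close>

locale potential_play = bounded_play +
  fixes \<sigma> :: real and W :: "nat \<Rightarrow> 'a \<Rightarrow> real" and L :: real and x\<^sub>0 :: 'a
  assumes \<sigma>: "\<bar>\<sigma>\<bar> = 1"
    and ball_sub: "\<And>x. x \<in> \<Omega> \<Longrightarrow> ball x \<epsilon> \<subseteq> \<Omega> \<union> outer_strip \<Omega> \<epsilon>"
    and W [measurable]: "\<And>n. W n \<in> borel_measurable borel"
    and W_ge: "\<And>n x. - L \<le> W n x" and L: "0 \<le> L"
    and W_strip: "\<And>n x. x \<in> outer_strip \<Omega> \<epsilon> \<Longrightarrow> \<sigma> * F x \<le> W n x"
    and W_leave: "\<And>n h. h \<in> space (histories n) \<Longrightarrow> h n \<in> \<Omega> \<Longrightarrow> snd q n h \<Longrightarrow> snd p n h \<Longrightarrow> 0 \<le> W n (h n)"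
    and W_pay: "\<And>n h. h \<in> space (histories n) \<Longrightarrow> h n \<in> \<Omega> \<Longrightarrow> snd q n h \<Longrightarrow> \<not> snd p n h \<Longrightarrow>
        W (Suc n) (fst p n h) - \<sigma> * \<epsilon> \<le> W n (h n)"
    and W_toss: "\<And>n h. h \<in> space (histories n) \<Longrightarrow> h n \<in> \<Omega> \<Longrightarrow> \<not> snd q n h \<Longrightarrow>
        (W (Suc n) (fst p n h) + W (Suc n) (fst q n h)) / 2 \<le> W n (h n)"
    and W_grow: "\<And>b. \<exists>n. \<forall>x\<in>\<Omega>. b \<le> W n x"
    and x\<^sub>0: "x\<^sub>0 \<in> \<Omega>"
begin

abbreviation "\<mu> \<equiv> path_measure \<Omega> p q x\<^sub>0"

abbreviation "C \<equiv> K + L + \<epsilon> * T"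

text \<open>A supermartingale, frozen when the game ends. Payments already made are booked
  separately, so \<open>W\<close> accounts only for the future. The shift by \<open>C\<close> in
  \<open>Y\<close> makes both branches nonnegative: \<open>K + \<epsilon> * T\<close> bounds the
  payoff, \<open>- L\<close> bounds \<open>W\<close> from below and \<open>\<epsilon> * T\<close>
  bounds the payments.\<close>

definition Z :: "nat \<Rightarrow> (nat \<Rightarrow> 'a) \<Rightarrow> real" where
  "Z n \<omega> = (if ended n \<omega> then \<sigma> * pf \<omega> else W n (\<omega> n) - \<sigma> * \<epsilon> * cost n \<omega>)"

abbreviation Y :: "nat \<Rightarrow> (nat \<Rightarrow> 'a) \<Rightarrow> ennreal" where
  "Y n \<omega> \<equiv> ennreal (Z n \<omega> + C)"

interpretation \<mu>: prob_space \<mu>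
  by (rule prob_space_path_measure[OF \<Omega> p q])

lemma \<sigma>_mult_le: "\<bar>\<sigma> * t\<bar> = \<bar>t\<bar>"
  using \<sigma> by (simp add: abs_mult)

lemma running_nonneg: "0 \<le> W n y - \<sigma> * \<epsilon> * cost m \<omega> + C"
proof -
  have "\<bar>\<sigma> * (\<epsilon> * cost m \<omega>)\<bar> \<le> \<epsilon> * T" unfolding \<sigma>_mult_le using cost_bounds'[of m \<omega>] by simp
  then have "\<sigma> * \<epsilon> * cost m \<omega> \<le> \<epsilon> * T" by (simp add: mult.assoc)
  with W_ge[of n y] K show ?thesis by simp
qed

lemma payoff_nonneg: "0 \<le> \<sigma> * pf \<omega> + C"
proof -
  have "\<bar>\<sigma> * pf \<omega>\<bar> \<le> K + \<epsilon> * T" unfolding \<sigma>_mult_le by (rule payoff_bounded)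
  with L show ?thesis by simp
qed

lemma measurable_Z [measurable]: "Z n \<in> borel_measurable paths"
proof -
  have [measurable]: "(\<lambda>\<omega>. W n (\<omega> n)) \<in> borel_measurable paths"
    by (rule measurable_compose[OF _ W]) simp
  show ?thesis unfolding Z_def by measurable
qed

lemma Z_cong: "restrict \<omega> {0..<Suc n} = restrict \<omega>' {0..<Suc n} \<Longrightarrow> Z n \<omega> = Z n \<omega>'"
  unfolding Z_def
  using ended_cong[of \<omega> n \<omega>'] payoff_cong[of \<omega> n \<omega>'] cost_cong[of \<omega> n \<omega>' n] restrict_eq_mono(2)[of \<omega> n \<omega>' n]
  by auto

text \<open>If the play ends exactly now, the payments agree on both sides and
  \<open>W_strip\<close> or \<open>W_leave\<close> compares the rest. The next position can thus be
  estimated by \<open>W\<close> without knowing whether the game ends there.\<close>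

lemma Z_le_running:
  assumes "\<omega> m \<in> \<Omega> \<union> outer_strip \<Omega> \<epsilon>"
    and first: "\<And>j. j < m \<Longrightarrow> \<not> ends_at \<Omega> p q \<omega> j"
  shows "Z m \<omega> \<le> W m (\<omega> m) - \<sigma> * \<epsilon> * cost m \<omega>"
proof (cases "ends_at \<Omega> p q \<omega> m")
  case True
  then have \<tau>: "end_time \<Omega> p q \<omega> = m" by (rule end_time_eqI) (rule first)
  let ?h = "restrict \<omega> {0..<Suc m}"
  have hm: "?h m = \<omega> m" by simp
  have "\<sigma> * (if \<omega> m \<in> outer_strip \<Omega> \<epsilon> then F (\<omega> m) else 0) \<le> W m (\<omega> m)"
  proof (cases "\<omega> m \<in> outer_strip \<Omega> \<epsilon>")
    case False
    then have in\<Omega>: "\<omega> m \<in> \<Omega>" using assms by auto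
    with True have "snd p m ?h" "snd q m ?h" by (auto simp: ends_at_def stops_def)
    then have "0 \<le> W m (?h m)" using in\<Omega> hm W_leave[of ?h m] restrict_histories by metis
    then show ?thesis using False by simp
  qed (simp add: W_strip)
  moreover have "ended m \<omega>" using True by (auto simp: ended_def)
  ultimately show ?thesis unfolding Z_def payoff_eq \<tau> by (simp add: right_diff_distrib mult.assoc)
next
  case False
  then have "\<not> ended m \<omega>" using first unfolding ended_def by (metis le_neq_implies_less)
  then show ?thesis by (simp add: Z_def)
qed

lemma step:
  assumes h: "h \<in> space (histories n)"
  shows "(\<integral>\<^sup>+y. Y (Suc n) (h(Suc n := y)) \<partial>transition \<Omega> p q n h) \<le> Y n h"
proof -
  have ext: "restrict h {0..<Suc n} = h"
    using h by (auto simp: space_PiM PiE_iff intro: extensional_restrict)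
  let ?h = "\<lambda>y. h(Suc n := y)"
  have eq: "restrict h {0..<Suc n} = restrict (?h y) {0..<Suc n}" for y
    by (auto simp: restrict_def)
  have tr: "prob_space (transition \<Omega> p q n h)"
    by (auto simp: transition_def intro!: prob_space_return prob_space.prob_space_distr measure_pmf.prob_space_axioms)
  have meas [measurable]: "(\<lambda>y. Y (Suc n) (?h y)) \<in> borel_measurable borel"
  proof -
    have "?h \<in> borel \<rightarrow>\<^sub>M paths"
      by (rule measurable_abs_UNIV) (auto simp: fun_upd_def)
    from measurable_compose[OF this measurable_Z] have "(\<lambda>y. Z (Suc n) (?h y)) \<in> borel_measurable borel" .
    then show ?thesis by measurable
  qed
  show ?thesis
  proof (cases "ended n h")
    case True
    have "ended (Suc n) (?h y)" for y
      using True ended_cong[OF eq[of y]] by (auto simp: ended_def intro: le_SucI)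
    moreover have "pf (?h y) = pf h" for y
      using payoff_cong[OF eq True, of y] by simp
    ultimately have "Y (Suc n) (?h y) = Y n h" for y
      using True by (simp add: Z_def)
    then show ?thesis using prob_space.emeasure_space_1[OF tr] by simp
  next
    case False
    then have ns: "\<not> stops \<Omega> p q n h" unfolding ended_def ends_at_def using ext by (metis order_refl)
    then have in\<Omega>: "h n \<in> \<Omega>" by (simp add: stops_def)
    have move: "fst p n h \<in> ball (h n) \<epsilon>" "fst q n h \<in> ball (h n) \<epsilon>"
      using p q h by (auto simp: strategies_def)
    have pay_n: "pay n h = of_bool (snd q n h) * (1 - of_bool (snd p n h))"
      unfolding pay_def ext ..
    \<comment> \<open>Turn \<open>n\<close> is decided before the token moves, so the payments up to
      time \<open>Suc n\<close> do not depend on \<open>y\<close>.\<close>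
    let ?R = "\<lambda>y. W (Suc n) y - \<sigma> * \<epsilon> * (cost n h + pay n h) + C"
    have Yle: "Y (Suc n) (?h y) \<le> ennreal (?R y)" and R0: "0 \<le> ?R y" if y: "y \<in> ball (h n) \<epsilon>" for y
    proof -
      have nend: "\<not> ends_at \<Omega> p q (?h y) j" if "j < Suc n" for j
        using False ends_at_cong[OF eq[of y], of j] that by (auto simp: ended_def)
      have c: "cost (Suc n) (?h y) = cost n h + pay n h"
        using cost_cong[OF eq[of y], of n] pay_cong[OF eq[of y], of n] by (simp add: cost_def)
      have "y \<in> \<Omega> \<union> outer_strip \<Omega> \<epsilon>" using ball_sub[OF in\<Omega>] y by auto
      then have "Z (Suc n) (?h y) \<le> W (Suc n) (?h y (Suc n)) - \<sigma> * \<epsilon> * cost (Suc n) (?h y)"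
        by (intro Z_le_running) (use nend in auto)
      then show "Y (Suc n) (?h y) \<le> ennreal (?R y)"
        unfolding c by (intro ennreal_leI) simp
      show "0 \<le> ?R y" using running_nonneg[of "Suc n" y "Suc n" "?h y"] unfolding c .
    qed
    have Yn: "Y n h = ennreal (W n (h n) - \<sigma> * \<epsilon> * cost n h + C)"
      using False by (simp add: Z_def)
    show ?thesis
    proof (cases "snd q n h")
      case True
      then have np: "\<not> snd p n h" using ns by (simp add: stops_def)
      have "transition \<Omega> p q n h = return borel (fst p n h)"
        using True ns by (simp add: transition_def)
      then have "(\<integral>\<^sup>+y. Y (Suc n) (?h y) \<partial>transition \<Omega> p q n h) = Y (Suc n) (?h (fst p n h))"
        by (simp add: nn_integral_return[OF _ meas])
      also have "\<dots> \<le> ennreal (?R (fst p n h))" by (rule Yle[OF move(1)])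
      also have "\<dots> \<le> Y n h"
        unfolding Yn using W_pay[OF h in\<Omega> True np] True np
        by (intro ennreal_leI) (simp add: pay_n distrib_left)
      finally show ?thesis .
    next
      case False
      have "transition \<Omega> p q n h = distr (measure_pmf (bernoulli_pmf (1/2))) borel
             (\<lambda>heads. if heads then fst p n h else fst q n h)"
        using False ns by (simp add: transition_def)
      then have "(\<integral>\<^sup>+y. Y (Suc n) (?h y) \<partial>transition \<Omega> p q n h)
          = Y (Suc n) (?h (fst p n h)) * ennreal (1/2) + Y (Suc n) (?h (fst q n h)) * ennreal (1/2)"
        by (simp add: nn_integral_distr)
      also have "\<dots> \<le> ennreal (?R (fst p n h)) * ennreal (1/2) + ennreal (?R (fst q n h)) * ennreal (1/2)"
        by (intro add_mono mult_right_mono Yle move) auto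
      also have "\<dots> = ennreal ((?R (fst p n h) + ?R (fst q n h)) / 2)"
        by (rule ennreal_mean) (rule R0[OF move(1)], rule R0[OF move(2)])
      also have "\<dots> \<le> Y n h"
        unfolding Yn using W_toss[OF h in\<Omega> False] False
        by (intro ennreal_leI) (simp add: pay_n)
      finally show ?thesis .
    qed
  qed
qed

lemma expectation_Z_le: "(\<integral>\<^sup>+\<omega>. Y n \<omega> \<partial>\<mu>) \<le> ennreal (W 0 x\<^sub>0 + C)"
proof (induction n)
  case 0
  have "(\<integral>\<^sup>+\<omega>. Y 0 \<omega> \<partial>\<mu>) = Y 0 (\<lambda>_. x\<^sub>0)"
  proof (rule nn_integral_path_measure_0[OF \<Omega> p q])
    show "Y 0 (restrict \<omega> {0..<Suc 0}) = Y 0 \<omega>" for \<omega>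
      by (subst Z_cong[of _ 0 \<omega>]) auto
  qed measurable
  also have "\<dots> \<le> ennreal (W 0 x\<^sub>0 + C)"
    using Z_le_running[of "\<lambda>_. x\<^sub>0" 0] x\<^sub>0 by (intro ennreal_leI) (simp add: cost_def)
  finally show ?case .
next
  case (Suc n)
  have "(\<integral>\<^sup>+\<omega>. Y (Suc n) \<omega> \<partial>\<mu>) \<le> (\<integral>\<^sup>+\<omega>. Y n \<omega> \<partial>\<mu>)"
  proof (rule nn_integral_path_measure_Suc[OF \<Omega> p q])
    show "Y (Suc n) (restrict \<omega> {0..<Suc (Suc n)}) = Y (Suc n) \<omega>" for \<omega>
      by (subst Z_cong[of _ "Suc n" \<omega>]) auto
    show "Y n (restrict \<omega> {0..<Suc n}) = Y n \<omega>" for \<omega>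
      by (subst Z_cong[of _ n \<omega>]) auto
  qed (measurable, rule step)
  with Suc show ?case by order
qed

text \<open>On a path that never ends the token is always in \<Omega>, and for suitable
  \<open>n\<close> the running potential exceeds any given bound there. Markov's inequality with the
  uniform bound on the mean gives \<open>b * prob N \<le> W 0 x\<^sub>0 + C\<close> for every
  \<open>b\<close>.\<close>

lemma ends: "ends_almost_surely \<Omega> p q x\<^sub>0"
proof -
  define N where "N = {\<omega>. \<forall>k. \<not> ends_at \<Omega> p q \<omega> k}"
  have N [measurable]: "N \<in> sets \<mu>"
  proof -
    have "{\<omega> \<in> space paths. \<forall>k. \<not> ends_at \<Omega> p q \<omega> k} \<in> sets paths" by measurable
    then show ?thesis by (simp add: N_def space_PiM sets_path_measure[OF \<Omega> p q])
  qed
  have meas_N: "b * \<mu>.prob N \<le> W 0 x\<^sub>0 + C" if b: "0 \<le> b" for b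
  proof -
    obtain n where n: "\<And>x. x \<in> \<Omega> \<Longrightarrow> b + \<epsilon> * T \<le> W n x"
      using W_grow[of "b + \<epsilon> * T"] by blast
    have "ennreal b * emeasure \<mu> N = (\<integral>\<^sup>+\<omega>. ennreal b * indicator N \<omega> \<partial>\<mu>)"
      by (simp add: nn_integral_cmult_indicator)
    also have "\<dots> \<le> (\<integral>\<^sup>+\<omega>. Y n \<omega> \<partial>\<mu>)"
    proof (intro nn_integral_mono)
      fix \<omega>
      show "ennreal b * indicator N \<omega> \<le> Y n \<omega>"
      proof (cases "\<omega> \<in> N")
        case True
        then have "\<not> ended n \<omega>" "\<not> stops \<Omega> p q n (restrict \<omega> {0..<Suc n})"
          by (auto simp: N_def ended_def ends_at_def)
        then have "Z n \<omega> = W n (\<omega> n) - \<sigma> * \<epsilon> * cost n \<omega>" "\<omega> n \<in> \<Omega>"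
          by (auto simp: Z_def stops_def)
        moreover have "\<bar>\<sigma> * (\<epsilon> * cost n \<omega>)\<bar> \<le> \<epsilon> * T"
          unfolding \<sigma>_mult_le using cost_bounds'[of n \<omega>] by simp
        ultimately have "b \<le> Z n \<omega> + C"
          using n[of "\<omega> n"] K L \<epsilon> by (simp add: mult.assoc)
        then show ?thesis using True by (simp add: ennreal_leI)
      qed simp
    qed
    also have "\<dots> \<le> ennreal (W 0 x\<^sub>0 + C)" by (rule expectation_Z_le)
    finally have "ennreal (b * \<mu>.prob N) \<le> ennreal (W 0 x\<^sub>0 + C)"
      using b by (simp add: \<mu>.emeasure_eq_measure ennreal_mult)
    then show ?thesis
      using running_nonneg[of 0 x\<^sub>0 0] b by (simp add: cost_def ennreal_le_iff)
  qed
  have "\<mu>.prob N = 0"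
  proof (rule ccontr)
    assume "\<mu>.prob N \<noteq> 0"
    then have pos: "0 < \<mu>.prob N" using measure_nonneg[of \<mu> N] by linarith
    have "0 \<le> W 0 x\<^sub>0 + C" using running_nonneg[of 0 x\<^sub>0 0] by (simp add: cost_def)
    then show False using meas_N[of "(W 0 x\<^sub>0 + C + 1) / \<mu>.prob N"] pos by simp
  qed
  then have "emeasure \<mu> N = 0" by (simp add: \<mu>.emeasure_eq_measure)
  moreover have "{\<omega> \<in> space \<mu>. \<not> (\<exists>k. ends_at \<Omega> p q \<omega> k)} = N"
    by (auto simp: N_def space_path_measure[OF \<Omega> p q])
  ultimately show ?thesis
    unfolding ends_almost_surely_def by (subst AE_iff_measurable[OF N]) auto
qed

text \<open>Fatou's lemma for the nonnegative \<open>Y n\<close>, which are eventually constant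
  along paths that end. With \<sigma> = 1 it bounds the expectation from above, with \<sigma> = -1
  from below. As the payoff is bounded, the extended expectation is the ordinary integral.\<close>

lemma expected_payoff_le:
  obtains m where "expected_payoff \<Omega> \<epsilon> F p q x\<^sub>0 = ereal m" "\<sigma> * m \<le> W 0 x\<^sub>0"
proof -
  have [measurable_cong]: "sets \<mu> = sets paths" by (rule sets_path_measure[OF \<Omega> p q])
  have int: "integrable \<mu> pf"
    by (rule \<mu>.integrable_const_bound[where B="K + \<epsilon> * T"]) (use payoff_bounded in auto)
  define m where "m = (\<integral>\<omega>. pf \<omega> \<partial>\<mu>)"
  have lim: "AE \<omega> in \<mu>. liminf (\<lambda>n. Y n \<omega>) = ennreal (\<sigma> * pf \<omega> + C)"
    using ends unfolding ends_almost_surely_def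
  proof (rule AE_mp, intro AE_I2 impI)
    fix \<omega> assume "\<exists>k. ends_at \<Omega> p q \<omega> k"
    then obtain k where k: "ends_at \<Omega> p q \<omega> k" by blast
    have "\<forall>\<^sub>F n in sequentially. Y n \<omega> = ennreal (\<sigma> * pf \<omega> + C)"
      using eventually_ge_at_top[of k]
    proof eventually_elim
      case (elim n)
      then have "ended n \<omega>" using k by (auto simp: ended_def)
      then show ?case by (simp add: Z_def)
    qed
    then have "(\<lambda>n. Y n \<omega>) \<longlonglongrightarrow> ennreal (\<sigma> * pf \<omega> + C)" by (rule tendsto_eventually)
    then show "liminf (\<lambda>n. Y n \<omega>) = ennreal (\<sigma> * pf \<omega> + C)"
      by (intro lim_imp_Liminf) simp_all
  qed
  have "ennreal (\<sigma> * m + C) = (\<integral>\<^sup>+\<omega>. ennreal (\<sigma> * pf \<omega> + C) \<partial>\<mu>)"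
    unfolding m_def using int payoff_nonneg
    by (subst nn_integral_eq_integral) (auto simp: \<mu>.prob_space)
  also have "\<dots> = (\<integral>\<^sup>+\<omega>. liminf (\<lambda>n. Y n \<omega>) \<partial>\<mu>)"
    by (rule nn_integral_cong_AE) (use lim in auto)
  also have "\<dots> \<le> liminf (\<lambda>n. \<integral>\<^sup>+\<omega>. Y n \<omega> \<partial>\<mu>)"
    by (rule nn_integral_liminf) measurable
  also have "\<dots> \<le> liminf (\<lambda>n. ennreal (W 0 x\<^sub>0 + C))"
    by (intro Liminf_mono always_eventually allI expectation_Z_le)
  also have "\<dots> = ennreal (W 0 x\<^sub>0 + C)"
    by (simp add: Liminf_const)
  finally have "\<sigma> * m \<le> W 0 x\<^sub>0"
    using running_nonneg[of 0 x\<^sub>0 0] by (simp add: cost_def ennreal_le_iff)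
  moreover have "expected_payoff \<Omega> \<epsilon> F p q x\<^sub>0 = ereal m"
  proof -
    have fin: "(\<integral>\<^sup>+\<omega>. ennreal (pf \<omega>) \<partial>\<mu>) \<noteq> \<infinity>" "(\<integral>\<^sup>+\<omega>. ennreal (- pf \<omega>) \<partial>\<mu>) \<noteq> \<infinity>"
      using int by (auto simp: real_integrable_def)
    have "m = enn2real (\<integral>\<^sup>+\<omega>. ennreal (pf \<omega>) \<partial>\<mu>) - enn2real (\<integral>\<^sup>+\<omega>. ennreal (- pf \<omega>) \<partial>\<mu>)"
      unfolding m_def by (rule real_lebesgue_integral_def[OF int])
    moreover have "enn2ereal t = ereal (enn2real t)" if "t \<noteq> \<infinity>" for t
      using that by (cases t) auto
    ultimately show ?thesis unfolding expected_payoff_def using fin by simp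
  qed
  ultimately show ?thesis using that by blast
qed

end

section \<open>Suprema and infima over balls\<close>

definition ball_sup :: "real \<Rightarrow> ('a::metric_space \<Rightarrow> real) \<Rightarrow> 'a \<Rightarrow> real" where
  "ball_sup \<epsilon> u x = (SUP y\<in>ball x \<epsilon>. u y)"

definition ball_inf :: "real \<Rightarrow> ('a::metric_space \<Rightarrow> real) \<Rightarrow> 'a \<Rightarrow> real" where
  "ball_inf \<epsilon> u x = (INF y\<in>ball x \<epsilon>. u y)"

lemma ball_sup_uminus: "ball_sup \<epsilon> (\<lambda>y. - u y) x = - ball_inf \<epsilon> u x"
  by (simp add: ball_sup_def ball_inf_def Inf_real_def image_image)

lemma ball_inf_uminus: "ball_inf \<epsilon> (\<lambda>y. - u y) x = - ball_sup \<epsilon> u x"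
  by (simp add: ball_sup_def ball_inf_def Inf_real_def image_image)

lemma bdd_range:
  fixes u :: "'a \<Rightarrow> real"
  assumes "\<forall>y. \<bar>u y\<bar> \<le> K"
  shows "bdd_above (u ` A)" "bdd_below (u ` A)"
  using assms by (auto intro!: bdd_aboveI2[where M=K] bdd_belowI2[where m="-K"] simp: abs_le_iff minus_le_iff)

lemma le_ball_sup: "(\<forall>y. \<bar>u y\<bar> \<le> K) \<Longrightarrow> y \<in> ball x \<epsilon> \<Longrightarrow> u y \<le> ball_sup \<epsilon> u x"
  unfolding ball_sup_def by (intro cSUP_upper bdd_range) auto

lemma ball_inf_le: "(\<forall>y. \<bar>u y\<bar> \<le> K) \<Longrightarrow> y \<in> ball x \<epsilon> \<Longrightarrow> ball_inf \<epsilon> u x \<le> u y"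
  unfolding ball_inf_def by (intro cINF_lower bdd_range) auto

lemma ball_sup_least: "0 < \<epsilon> \<Longrightarrow> (\<And>y. y \<in> ball x \<epsilon> \<Longrightarrow> u y \<le> c) \<Longrightarrow> ball_sup \<epsilon> u x \<le> c"
  unfolding ball_sup_def by (intro cSUP_least) auto

lemma ball_inf_greatest: "0 < \<epsilon> \<Longrightarrow> (\<And>y. y \<in> ball x \<epsilon> \<Longrightarrow> c \<le> u y) \<Longrightarrow> c \<le> ball_inf \<epsilon> u x"
  unfolding ball_inf_def by (intro cINF_greatest) auto

lemma ball_inf_less:
  assumes "\<forall>y. \<bar>u y\<bar> \<le> K" "0 < \<epsilon>" "ball_inf \<epsilon> u x < r"
  obtains y where "y \<in> ball x \<epsilon>" "u y < r"
proof -
  have "\<exists>y\<in>ball x \<epsilon>. u y < r"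
    using assms(2,3) bdd_range(2)[OF assms(1)] unfolding ball_inf_def
    by (subst (asm) cINF_less_iff) auto
  then show ?thesis using that by blast
qed

lemma ball_sup_mono:
  "(\<forall>y. \<bar>v y\<bar> \<le> K) \<Longrightarrow> 0 < \<epsilon> \<Longrightarrow> (\<forall>y. u y \<le> v y) \<Longrightarrow> ball_sup \<epsilon> u x \<le> ball_sup \<epsilon> v x"
  by (rule ball_sup_least) (use le_ball_sup order_trans in blast)+

lemma ball_inf_mono:
  "(\<forall>y. \<bar>u y\<bar> \<le> K) \<Longrightarrow> 0 < \<epsilon> \<Longrightarrow> (\<forall>y. u y \<le> v y) \<Longrightarrow> ball_inf \<epsilon> u x \<le> ball_inf \<epsilon> v x"
  by (rule ball_inf_greatest) (use ball_inf_le order_trans in blast)+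

lemma ball_sup_ge_self: "(\<forall>y. \<bar>u y\<bar> \<le> K) \<Longrightarrow> 0 < \<epsilon> \<Longrightarrow> u x \<le> ball_sup \<epsilon> u x"
  by (rule le_ball_sup) auto

lemma ball_inf_le_self: "(\<forall>y. \<bar>u y\<bar> \<le> K) \<Longrightarrow> 0 < \<epsilon> \<Longrightarrow> ball_inf \<epsilon> u x \<le> u x"
  by (rule ball_inf_le) auto

lemma ball_bounds:
  assumes "\<forall>y. \<bar>u y\<bar> \<le> K" "0 < \<epsilon>"
  shows "\<bar>ball_sup \<epsilon> u x\<bar> \<le> K" "\<bar>ball_inf \<epsilon> u x\<bar> \<le> K"
proof -
  have u: "- K \<le> u y" "u y \<le> K" for y using assms(1) by (auto simp: abs_le_iff minus_le_iff)
  have "- K \<le> ball_inf \<epsilon> u x" "ball_sup \<epsilon> u x \<le> K"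
    by (rule ball_inf_greatest[OF assms(2) u(1)], rule ball_sup_least[OF assms(2) u(2)])
  then show "\<bar>ball_sup \<epsilon> u x\<bar> \<le> K" "\<bar>ball_inf \<epsilon> u x\<bar> \<le> K"
    using ball_sup_ge_self[OF assms, of x] ball_inf_le_self[OF assms, of x] u[of x] by auto
qed

lemma borel_measurable_ball_sup:
  fixes u :: "'a::metric_space \<Rightarrow> real"
  assumes "\<forall>y. \<bar>u y\<bar> \<le> K" "0 < \<epsilon>"
  shows "ball_sup \<epsilon> u \<in> borel_measurable borel"
  unfolding borel_measurable_iff_greater
proof
  fix a
  have "{x. a < ball_sup \<epsilon> u x} = (\<Union>y\<in>{y. a < u y}. ball y \<epsilon>)"
    using assms bdd_range(1)[OF assms(1)] unfolding ball_sup_def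
    by (subst less_cSUP_iff) (auto simp: dist_commute)
  then have "open {x. a < ball_sup \<epsilon> u x}" by auto
  then show "{x \<in> space borel. a < ball_sup \<epsilon> u x} \<in> sets borel" by simp
qed

lemma borel_measurable_ball_inf:
  fixes u :: "'a::metric_space \<Rightarrow> real"
  assumes "\<forall>y. \<bar>u y\<bar> \<le> K" "0 < \<epsilon>"
  shows "ball_inf \<epsilon> u \<in> borel_measurable borel"
proof -
  have "(\<lambda>x. - ball_sup \<epsilon> (\<lambda>y. - u y) x) \<in> borel_measurable borel"
    by (intro borel_measurable_uminus borel_measurable_ball_sup[where K=K]) (use assms in auto)
  then show ?thesis by (simp add: ball_sup_uminus)
qed

text \<open>
  The selection is made from a countable set that is dense in every sublevel set of \<open>v\<close> with
  rational level; openness of the balls makes such a set large enough.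
\<close>

lemma near_infimum_selector:
  fixes v :: "'a::{metric_space, second_countable_topology} \<Rightarrow> real"
  assumes v: "\<forall>y. \<bar>v y\<bar> \<le> K" and "0 < \<epsilon>" "0 < \<delta>"
  obtains s where "s \<in> borel_measurable borel" "\<And>x. s x \<in> ball x \<epsilon>"
    "\<And>x. v (s x) < ball_inf \<epsilon> v x + \<delta>"
proof -
  have "\<exists>D. countable D \<and> D \<subseteq> {y. v y < r} \<and> {y. v y < r} \<subseteq> closure D" for r
    by (metis separable)
  then obtain D where D: "\<And>r. countable (D r)" "\<And>r. D r \<subseteq> {y. v y < r}" "\<And>r. {y. v y < r} \<subseteq> closure (D r)"
    by metis
  define E where "E = (\<Union>r\<in>\<rat>. D r)"
  have "countable E" unfolding E_def using D(1) countable_rat by auto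
  have ex: "\<exists>d\<in>E. d \<in> ball x \<epsilon> \<and> v d < ball_inf \<epsilon> v x + \<delta>" for x
  proof -
    obtain y where y: "y \<in> ball x \<epsilon>" "v y < ball_inf \<epsilon> v x + \<delta>"
      using ball_inf_less[OF v \<open>0 < \<epsilon>\<close>, of x "ball_inf \<epsilon> v x + \<delta>"] \<open>0 < \<delta>\<close> by auto
    then obtain r where r: "r \<in> \<rat>" "v y < r" "r < ball_inf \<epsilon> v x + \<delta>"
      using Rats_dense_in_real by blast
    then have "y \<in> closure (D r)" using D(3) by auto
    then have "ball x \<epsilon> \<inter> D r \<noteq> {}"
      using y(1) open_ball[of x \<epsilon>] by (metis disjoint_iff closure_iff_nhds_not_empty subset_refl)
    then obtain d where "d \<in> D r" "d \<in> ball x \<epsilon>" by auto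
    moreover from this have "v d < ball_inf \<epsilon> v x + \<delta>" using D(2)[of r] r(3) by auto
    ultimately show ?thesis using r(1) by (auto simp: E_def)
  qed
  then have "E \<noteq> {}" by auto
  define d where "d = from_nat_into E"
  have range_d: "range d = E" unfolding d_def using \<open>E \<noteq> {}\<close> \<open>countable E\<close> by (rule range_from_nat_into)
  let ?P = "\<lambda>x i. d i \<in> ball x \<epsilon> \<and> v (d i) < ball_inf \<epsilon> v x + \<delta>"
  \<comment> \<open>Taking the first admissible point of a fixed enumeration keeps the choice Borel,
    since admissibility of each point is a Borel condition on \<open>x\<close>.\<close>
  define s where "s x = d (LEAST i. ?P x i)" for x
  have "?P x (LEAST i. ?P x i)" for x
  proof (rule LeastI_ex)
    show "\<exists>i. ?P x i" using ex[of x] range_d by (metis imageE)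
  qed
  then have s: "s x \<in> ball x \<epsilon>" "v (s x) < ball_inf \<epsilon> v x + \<delta>" for x
    by (simp_all add: s_def)
  have [measurable]: "ball_inf \<epsilon> v \<in> borel_measurable borel"
    by (rule borel_measurable_ball_inf[OF v \<open>0 < \<epsilon>\<close>])
  have "(\<lambda>x. d (LEAST i. dist x (d i) < \<epsilon> \<and> v (d i) < ball_inf \<epsilon> v x + \<delta>)) \<in> borel_measurable borel"
    by measurable
  then have "s \<in> borel_measurable borel" unfolding s_def[abs_def] by simp
  with s show ?thesis using that by blast
qed

text \<open>Knaster-Tarski for functions with values in \<open>[-K, K]\<close>, a complete lattice
  although the type of real functions is not one: the supremum of all subsolutions is a fixed point.
  That subsolutions lie below it gives the lower bound in \<open>patching\<close>.\<close>

lemma bounded_greatest_fixed_point: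
  fixes Q :: "('a \<Rightarrow> real) \<Rightarrow> 'a \<Rightarrow> real"
  assumes K: "0 \<le> K"
    and maps: "\<And>v x. (\<forall>x. \<bar>v x\<bar> \<le> K) \<Longrightarrow> \<bar>Q v x\<bar> \<le> K"
    and mono: "\<And>u v x. (\<forall>x. \<bar>u x\<bar> \<le> K) \<Longrightarrow> (\<forall>x. \<bar>v x\<bar> \<le> K) \<Longrightarrow> (\<forall>x. u x \<le> v x) \<Longrightarrow> Q u x \<le> Q v x"
  obtains v where "\<forall>x. \<bar>v x\<bar> \<le> K" "Q v = v"
    "\<And>z x. (\<forall>x. \<bar>z x\<bar> \<le> K) \<Longrightarrow> (\<forall>x. z x \<le> Q z x) \<Longrightarrow> z x \<le> v x"
proof -
  define P where "P = {z. (\<forall>x. \<bar>z x\<bar> \<le> K) \<and> (\<forall>x. z x \<le> Q z x)}"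
  define v where "v x = (SUP z\<in>P. z x)" for x
  have K': "(\<lambda>_. - K) \<in> P"
  proof -
    have "- K \<le> Q (\<lambda>_. - K) x" for x using maps[of "\<lambda>_. - K" x] K by auto
    then show ?thesis using K by (auto simp: P_def)
  qed
  have bdd: "bdd_above ((\<lambda>z. z x) ` P)" for x
    by (rule bdd_aboveI2[where M=K]) (auto simp: P_def abs_le_iff)
  have le_v: "z x \<le> v x" if "z \<in> P" for z x
    unfolding v_def using that bdd by (rule cSUP_upper)
  have v_le: "v x \<le> c" if "\<And>z. z \<in> P \<Longrightarrow> z x \<le> c" for x c
    unfolding v_def using that K' by (intro cSUP_least) auto
  have bv: "\<forall>x. \<bar>v x\<bar> \<le> K"
  proof
    fix x show "\<bar>v x\<bar> \<le> K"
      using le_v[OF K', of x] v_le[of x K] by (auto simp: P_def abs_le_iff)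
  qed
  have v_Q: "v x \<le> Q v x" for x
  proof (rule v_le)
    fix z assume z: "z \<in> P"
    then have "z x \<le> Q z x" by (simp add: P_def)
    also have "\<dots> \<le> Q v x" using z bv le_v[OF z] by (intro mono) (auto simp: P_def)
    finally show "z x \<le> Q v x" .
  qed
  then have "Q v \<in> P" using maps[OF bv] bv mono[of v "Q v"] by (auto simp: P_def)
  then have "Q v = v" using v_Q le_v by (intro ext antisym) auto
  then show ?thesis using that[of v] bv le_v by (auto simp: P_def)
qed

text \<open>Every operation on the right-hand side is monotone in \<open>u\<close> and preserves
  bounds by \<open>K\<close>: the payment branch lies between 0 and \<open>K\<close> because
  \<epsilon> > 0.\<close>

lemma dynamic_programming_solution:
  fixes f :: "'a::metric_space \<Rightarrow> real"
  assumes [measurable]: "\<Omega> \<in> sets borel" "f \<in> borel_measurable borel"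
    and f: "\<forall>x. \<bar>f x\<bar> \<le> K" and \<epsilon>: "0 < \<epsilon>"
  obtains u where "u \<in> borel_measurable borel" "\<forall>x. \<bar>u x\<bar> \<le> K" "\<And>x. x \<notin> \<Omega> \<Longrightarrow> u x = f x"
    "\<And>x. x \<in> \<Omega> \<Longrightarrow> u x = min ((ball_sup \<epsilon> u x + ball_inf \<epsilon> u x) / 2) (max 0 (ball_sup \<epsilon> u x - \<epsilon>))"
proof -
  define Q where "Q u x = (if x \<in> \<Omega> then
      min ((ball_sup \<epsilon> u x + ball_inf \<epsilon> u x) / 2) (max 0 (ball_sup \<epsilon> u x - \<epsilon>)) else f x)" for u x
  have K: "0 \<le> K" using f[THEN spec, of undefined] by linarith
  obtain u where u: "\<forall>x. \<bar>u x\<bar> \<le> K" "Q u = u"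
  proof (rule bounded_greatest_fixed_point[OF K, of Q])
    fix v :: "'a \<Rightarrow> real" and x assume v: "\<forall>x. \<bar>v x\<bar> \<le> K"
    show "\<bar>Q v x\<bar> \<le> K"
      using ball_bounds[OF v \<epsilon>, of x] f[THEN spec, of x] K \<epsilon> unfolding Q_def by (auto simp: min_def max_def)
  next
    fix u v :: "'a \<Rightarrow> real" and x
    assume u: "\<forall>x. \<bar>u x\<bar> \<le> K" and v: "\<forall>x. \<bar>v x\<bar> \<le> K" and uv: "\<forall>x. u x \<le> v x"
    have "ball_sup \<epsilon> u x \<le> ball_sup \<epsilon> v x" "ball_inf \<epsilon> u x \<le> ball_inf \<epsilon> v x"
      by (rule ball_sup_mono[OF v \<epsilon> uv], rule ball_inf_mono[OF u \<epsilon> uv])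
    then show "Q u x \<le> Q v x"
      unfolding Q_def by (auto simp: min_def max_def)
  qed blast
  have [measurable]: "ball_sup \<epsilon> u \<in> borel_measurable borel" "ball_inf \<epsilon> u \<in> borel_measurable borel"
    by (rule borel_measurable_ball_sup[OF u(1) \<epsilon>], rule borel_measurable_ball_inf[OF u(1) \<epsilon>])
  have "Q u \<in> borel_measurable borel" unfolding Q_def by measurable
  then have "u \<in> borel_measurable borel" unfolding u(2) .
  moreover have "u x = Q u x" for x using u(2) by simp
  ultimately show ?thesis using that[of u] u(1) unfolding Q_def by auto
qed

section \<open>Repairing a function on the region where it is flat\<close>

lemma bounded_escape:
  fixes \<Omega> :: "'a::real_normed_vector set"
  assumes "bounded \<Omega>" "e \<noteq> 0"
  obtains N :: nat where "\<And>x. x \<in> \<Omega> \<Longrightarrow> x + real N *\<^sub>R e \<notin> \<Omega>"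
proof -
  obtain B where B: "\<And>x. x \<in> \<Omega> \<Longrightarrow> norm x \<le> B" using assms(1) by (auto simp: bounded_iff)
  obtain N :: nat where N: "2 * B < N * norm e" using reals_Archimedean3[of "norm e"] assms(2) by auto
  have "x + real N *\<^sub>R e \<notin> \<Omega>" if x: "x \<in> \<Omega>" for x
  proof
    assume "x + real N *\<^sub>R e \<in> \<Omega>"
    then have "norm (x + real N *\<^sub>R e) \<le> B" by (rule B)
    moreover have "norm (real N *\<^sub>R e) \<le> norm (x + real N *\<^sub>R e) + norm x"
      using norm_triangle_ineq4[of "x + real N *\<^sub>R e" x] by simp
    ultimately show False using B[OF x] N by simp
  qed
  then show ?thesis using that by blast
qed

text \<open>
  On \<open>V\<close>, where \<open>u\<close> varies slowly, \<open>u\<close> is replaced by the least cost of a chain leaving \<open>V\<close>, each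
  step costing \<open>k\<close>; since \<open>N\<close> steps suffice, little is changed.
\<close>

lemma patching:
  fixes u :: "'a::real_normed_vector \<Rightarrow> real"
  assumes [measurable]: "u \<in> borel_measurable borel" "V \<in> sets borel"
    and u: "\<forall>x. \<bar>u x\<bar> \<le> K" and \<epsilon>: "0 < \<epsilon>" and k: "0 \<le> k"
    and flat: "\<And>x y. x \<in> V \<Longrightarrow> y \<in> ball x \<epsilon> \<Longrightarrow> \<bar>u y - u x\<bar> \<le> k"
    and e: "norm e < \<epsilon>" and N: "\<And>x. x \<in> V \<Longrightarrow> x + real N *\<^sub>R e \<notin> V"
  obtains v where "v \<in> borel_measurable borel" "\<And>x. x \<notin> V \<Longrightarrow> v x = u x"
    "\<And>x. u x \<le> v x" "\<And>x. v x \<le> u x + 2 * real N * k"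
    "\<And>x. x \<in> V \<Longrightarrow> ball_inf \<epsilon> v x = v x - k"
    "\<And>x y. x \<in> V \<or> y \<in> V \<Longrightarrow> y \<in> ball x \<epsilon> \<Longrightarrow> v y \<le> v x + k"
proof -
  \<comment> \<open>The cap keeps the operator among bounded functions. By the extra 1 it lies
    strictly above every value that the chain estimate allows, so it is never active on
    \<open>V\<close> at the fixed point.\<close>
  define K' where "K' = K + 2 * real N * k + 1"
  have K: "0 \<le> K" using u[THEN spec, of undefined] by linarith
  have Nk: "0 \<le> 2 * real N * k" using k by simp
  have K': "0 \<le> K'" "K \<le> K'" unfolding K'_def using K Nk by linarith+
  have u': "\<forall>x. \<bar>u x\<bar> \<le> K'" using u K' by (meson order_trans)
  define Q where "Q v x = (if x \<in> V then min K' (ball_inf \<epsilon> v x + k) else u x)" for v x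
  obtain v where v: "\<forall>x. \<bar>v x\<bar> \<le> K'" "Q v = v"
    and great: "\<And>z x. (\<forall>x. \<bar>z x\<bar> \<le> K') \<Longrightarrow> (\<forall>x. z x \<le> Q z x) \<Longrightarrow> z x \<le> v x"
  proof (rule bounded_greatest_fixed_point[OF K'(1), of Q])
    fix v :: "'a \<Rightarrow> real" and x assume v: "\<forall>x. \<bar>v x\<bar> \<le> K'"
    show "\<bar>Q v x\<bar> \<le> K'"
      using ball_bounds(2)[OF v \<epsilon>, of x] u'[THEN spec, of x] K' k unfolding Q_def by (auto simp: min_def)
  next
    fix u v :: "'a \<Rightarrow> real" and x
    assume "\<forall>x. \<bar>u x\<bar> \<le> K'" and "\<forall>x. \<bar>v x\<bar> \<le> K'" and "\<forall>x. u x \<le> v x"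
    then have "ball_inf \<epsilon> u x \<le> ball_inf \<epsilon> v x" by (intro ball_inf_mono[OF _ \<epsilon>])
    then show "Q u x \<le> Q v x" unfolding Q_def by auto
  qed blast
  have v_eq: "v x = Q v x" for x using v(2) by simp
  have out: "v x = u x" if "x \<notin> V" for x using v_eq[of x] that by (simp add: Q_def)
  \<comment> \<open>By flatness a step from \<open>V\<close> lowers \<open>u\<close> by at most
    \<open>k\<close>, so \<open>u\<close> is a subsolution and lies below the greatest fixed
    point.\<close>
  have sub: "\<forall>x. u x \<le> Q u x"
  proof
    fix x
    show "u x \<le> Q u x"
    proof (cases "x \<in> V")
      case True
      have "u x - k \<le> ball_inf \<epsilon> u x"
        by (rule ball_inf_greatest[OF \<epsilon>]) (use flat[OF True] in force)
      then show ?thesis using True u'[THEN spec, of x] by (auto simp: Q_def abs_le_iff)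
    qed (simp add: Q_def)
  qed
  have lower: "u x \<le> v x" for x
    by (rule great[OF u' sub])
  \<comment> \<open>Each step along \<open>e\<close> costs \<open>k\<close> by the fixed point
    equation and may raise \<open>u\<close> by another \<open>k\<close>, hence the factor 2.\<close>
  have chain: "v x \<le> u x + 2 * real n * k" if "x + real n *\<^sub>R e \<notin> V" for n :: nat and x
    using that
  proof (induction n arbitrary: x)
    case 0
    then show ?case using out[of x] by simp
  next
    case (Suc n)
    show ?case
    proof (cases "x \<in> V")
      case True
      have near: "x + e \<in> ball x \<epsilon>" using e by (simp add: dist_norm)
      have "v x \<le> ball_inf \<epsilon> v x + k" using v_eq[of x] True by (simp add: Q_def)
      also have "\<dots> \<le> v (x + e) + k" using ball_inf_le[OF v(1) near] by simp
      also have "v (x + e) \<le> u (x + e) + 2 * real n * k"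
        using Suc.prems by (intro Suc.IH) (simp add: algebra_simps)
      also have "u (x + e) \<le> u x + k" using flat[OF True near] by linarith
      finally show ?thesis by (simp add: algebra_simps)
    qed (use out k in simp)
  qed
  have upper: "v x \<le> u x + 2 * real N * k" for x
  proof (cases "x \<in> V")
    case True
    then show ?thesis by (intro chain N)
  qed (use out Nk in simp)
  have onV: "ball_inf \<epsilon> v x = v x - k" if "x \<in> V" for x
  proof -
    have "v x < K'" using upper[of x] u[THEN spec, of x] unfolding K'_def by linarith
    then show ?thesis using v_eq[of x] that by (auto simp: Q_def min_def split: if_splits)
  qed
  \<comment> \<open>If \<open>y\<close> is in \<open>V\<close>, its own equation applies, as
    \<open>x\<close> lies in the ball around \<open>y\<close>; otherwise \<open>x\<close> is in
    \<open>V\<close> and flatness of \<open>u\<close> there suffices.\<close>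
  have lip: "v y \<le> v x + k" if "x \<in> V \<or> y \<in> V" "y \<in> ball x \<epsilon>" for x y
  proof (cases "y \<in> V")
    case True
    have "ball_inf \<epsilon> v y \<le> v x" using that by (intro ball_inf_le[OF v(1)]) (simp add: dist_commute)
    then show ?thesis using onV[OF True] by simp
  next
    case False
    with that have "u y \<le> u x + k" using flat[of x y] by force
    then show ?thesis using out[OF False] lower[of x] by simp
  qed
  have [measurable]: "ball_inf \<epsilon> v \<in> borel_measurable borel"
    by (rule borel_measurable_ball_inf[OF v(1) \<epsilon>])
  have "Q v \<in> borel_measurable borel" unfolding Q_def by measurable
  then have "v \<in> borel_measurable borel" unfolding v(2) .
  then show ?thesis using that out lower upper onV lip by blast
qed

section \<open>Strict potentials near a solution\<close>

text \<open>
  Composition with a concave quadratic makes the mean value inequality strict.  The slope of \<open>g\<close> is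
  kept below \<open>1\<close> for Player II, who then gains whenever Player I pays \<open>\<epsilon>\<close> for climbing by at most
  \<open>\<epsilon>\<close>, and above \<open>1\<close> for Player I.
\<close>

lemma concave_bending:
  fixes K k \<epsilon> \<eta> r :: real
  assumes "0 \<le> K" "0 < k" "0 < \<epsilon>" "0 < \<eta>" and r: "r = 1 \<or> r = - 1"
  obtains g :: "real \<Rightarrow> real" and c \<delta> :: real where
    "continuous_on UNIV g" "0 < c" "0 < \<delta>"
    "\<And>t. \<bar>t\<bar> \<le> K \<Longrightarrow> t \<le> g t \<and> g t \<le> t + \<eta>"
    "\<And>s t b. \<bar>s\<bar> \<le> K \<Longrightarrow> \<bar>t\<bar> \<le> K \<Longrightarrow> \<bar>b\<bar> \<le> K \<Longrightarrow> s \<le> t - k / 2 \<Longrightarrow> s + b \<le> 2 * t + \<delta> \<Longrightarrow>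
      (g s + g b) / 2 \<le> g t - c"
    "\<And>t b. \<bar>t\<bar> \<le> K \<Longrightarrow> \<bar>b\<bar> \<le> K \<Longrightarrow> r = - 1 \<Longrightarrow> b \<le> t + \<epsilon> \<Longrightarrow> g b - \<epsilon> \<le> g t - c"
    "\<And>s t. \<bar>s\<bar> \<le> K \<Longrightarrow> \<bar>t\<bar> \<le> K \<Longrightarrow> r = 1 \<Longrightarrow> s \<le> t - \<epsilon> + \<delta> \<Longrightarrow> g s + \<epsilon> \<le> g t - c"
proof -
  \<comment> \<open>\<open>\<alpha>\<close> bounds the remaining correction
    \<open>2 * (K + 1) * r * t - t\<^sup>2\<close>, so that \<open>g\<close> lies above the
    identity.\<close>
  define \<alpha> where "\<alpha> = 2 * K * (K + 1) + K\<^sup>2"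
  \<comment> \<open>The first bound keeps the difference quotients of \<open>g\<close> between 0 and
    2, the second keeps \<open>g\<close> within \<eta> of the identity.\<close>
  define \<kappa> where "\<kappa> = min (1 / (4 * (K + 1))) (\<eta> / (2 * \<alpha> + 1))"
  \<comment> \<open>A deviation by \<open>k / 2\<close> has square \<open>k\<^sup>2 / 4\<close>,
    which covers \<open>4 * m\<close>; the other bound serves the payment steps. Both
    \<open>c\<close> and \<open>\<delta>\<close> will be \<open>\<kappa> * m\<close>.\<close>
  define m where "m = min (k\<^sup>2 / 16) (\<epsilon> / 2)"
  \<comment> \<open>Difference quotients of \<open>g\<close> are
    \<open>\<beta> - \<kappa> * (s + t)\<close> with \<open>\<bar>s + t\<bar> \<le> 2 * K\<close>;
    this offset leaves a margin of \<open>2 * \<kappa>\<close> on the side of 1 selected by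
    \<open>r\<close>.\<close>
  define \<beta> where "\<beta> = 1 + 2 * \<kappa> * (K + 1) * r"
  define g where "g t = \<kappa> * \<alpha> + \<beta> * t - \<kappa> * t\<^sup>2" for t
  have \<alpha>: "0 \<le> \<alpha>" using assms(1) by (simp add: \<alpha>_def)
  have \<kappa>: "0 < \<kappa>" using assms \<alpha> by (auto simp: \<kappa>_def add_nonneg_pos)
  have "\<kappa> \<le> 1 / (4 * (K + 1))" unfolding \<kappa>_def by simp
  then have \<kappa>K: "4 * (\<kappa> * (K + 1)) \<le> 1" using assms(1) by (simp add: field_simps)
  have "\<kappa> * 1 \<le> \<kappa> * (K + 1)" using \<kappa> assms(1) by (intro mult_left_mono) auto
  then have \<kappa>1: "4 * \<kappa> \<le> 1" using \<kappa>K by linarith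
  have "\<kappa> \<le> \<eta> / (2 * \<alpha> + 1)" unfolding \<kappa>_def by simp
  then have "\<kappa> * (2 * \<alpha> + 1) \<le> \<eta>" using \<alpha> by (simp add: pos_le_divide_eq)
  then have \<kappa>\<alpha>: "2 * (\<kappa> * \<alpha>) \<le> \<eta>" using \<kappa> by (simp add: algebra_simps)
  have m: "0 < m" "16 * m \<le> k\<^sup>2" "2 * m \<le> \<epsilon>" using assms by (auto simp: m_def)
  have \<beta>: "\<beta> = 1 + 2 * (\<kappa> * (K + 1)) * r" by (simp add: \<beta>_def)
  have \<kappa>t: "\<bar>\<kappa> * t\<bar> \<le> \<kappa> * K" if "\<bar>t\<bar> \<le> K" for t
    using that \<kappa> by (simp add: abs_mult mult_left_mono)
  have slope0: "0 \<le> \<beta> - \<kappa> * (s + t)" "\<beta> - \<kappa> * (s + t) \<le> 2" if "\<bar>s\<bar> \<le> K" "\<bar>t\<bar> \<le> K" for s t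
    using \<kappa>t[OF that(1)] \<kappa>t[OF that(2)] \<kappa>K \<kappa> r by (auto simp: \<beta> distrib_left)
  have slopeII: "\<beta> - \<kappa> * (s + t) \<le> 1 - 2 * \<kappa>" if "\<bar>s\<bar> \<le> K" "\<bar>t\<bar> \<le> K" "r = - 1" for s t
    using \<kappa>t[OF that(1)] \<kappa>t[OF that(2)] that(3) by (auto simp: \<beta> distrib_left)
  have slopeI: "1 + 2 * \<kappa> \<le> \<beta> - \<kappa> * (s + t)" if "\<bar>s\<bar> \<le> K" "\<bar>t\<bar> \<le> K" "r = 1" for s t
    using \<kappa>t[OF that(1)] \<kappa>t[OF that(2)] that(3) by (auto simp: \<beta> distrib_left)
  have diff: "g s - g t = (s - t) * (\<beta> - \<kappa> * (s + t))" for s t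
    by (simp add: g_def algebra_simps power2_eq_square)
  have "t \<le> g t \<and> g t \<le> t + \<eta>" if t: "\<bar>t\<bar> \<le> K" for t
  proof -
    have g_eq: "g t = t + \<kappa> * (\<alpha> + (2 * (K + 1) * r * t - t\<^sup>2))"
      by (simp add: g_def \<beta> algebra_simps)
    have t2: "0 \<le> t\<^sup>2" "t\<^sup>2 \<le> K\<^sup>2" "0 \<le> K\<^sup>2" using t abs_le_square_iff[of t K] assms(1) by auto
    have "\<bar>2 * (K + 1) * t\<bar> \<le> 2 * (K + 1) * K"
      using t assms(1) by (simp add: abs_mult mult_left_mono)
    moreover have "\<bar>2 * (K + 1) * r * t\<bar> = \<bar>2 * (K + 1) * t\<bar>" using r by (auto simp: abs_mult)
    ultimately have rt: "\<bar>2 * (K + 1) * r * t\<bar> \<le> 2 * K * (K + 1)" by (simp only: mult_ac)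
    have "0 \<le> (M + L) + (X - T) \<and> (M + L) + (X - T) \<le> 2 * (M + L)"
      if "\<bar>X\<bar> \<le> M" "0 \<le> T" "T \<le> L" for X M T L :: real
      using that by auto
    from this[OF rt t2(1,2)]
    have "0 \<le> \<alpha> + (2 * (K + 1) * r * t - t\<^sup>2)" "\<alpha> + (2 * (K + 1) * r * t - t\<^sup>2) \<le> 2 * \<alpha>"
      unfolding \<alpha>_def by blast+
    then have "0 \<le> \<kappa> * (\<alpha> + (2 * (K + 1) * r * t - t\<^sup>2))"
      "\<kappa> * (\<alpha> + (2 * (K + 1) * r * t - t\<^sup>2)) \<le> \<kappa> * (2 * \<alpha>)"
      using \<kappa> by (auto intro: mult_left_mono)
    then show ?thesis using g_eq \<kappa>\<alpha> by linarith
  qed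
  moreover have "(g s + g b) / 2 \<le> g t - \<kappa> * m"
    if *: "\<bar>s\<bar> \<le> K" "\<bar>t\<bar> \<le> K" "\<bar>b\<bar> \<le> K" "s \<le> t - k / 2" "s + b \<le> 2 * t + \<kappa> * m" for s t b
  proof -
    \<comment> \<open>An exact second difference: the first term is at most
      \<open>2 * \<kappa> * m\<close>, the squares contribute at least
      \<open>4 * \<kappa> * m\<close>, and halving leaves a drop of
      \<open>\<kappa> * m\<close>.\<close>
    have e: "g s + g b - 2 * g t
        = (s + b - 2 * t) * (\<beta> - \<kappa> * (t + t)) - \<kappa> * ((t - s)\<^sup>2 + (b - t)\<^sup>2)"
      by (simp add: g_def algebra_simps power2_eq_square)
    have "(s + b - 2 * t) * (\<beta> - \<kappa> * (t + t)) \<le> (\<kappa> * m) * (\<beta> - \<kappa> * (t + t))"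
      using * slope0[of t t] by (intro mult_right_mono) auto
    also have "\<dots> \<le> (\<kappa> * m) * 2"
      using slope0[of t t] * \<kappa> m by (intro mult_left_mono) auto
    finally have 1: "(s + b - 2 * t) * (\<beta> - \<kappa> * (t + t)) \<le> 2 * (\<kappa> * m)" by simp
    have "(k / 2)\<^sup>2 \<le> (t - s)\<^sup>2" using *(4) assms(2) by (intro power_mono) auto
    then have "4 * m \<le> (t - s)\<^sup>2 + (b - t)\<^sup>2" using m(2) by (simp add: power_divide add_increasing2)
    then have "\<kappa> * (4 * m) \<le> \<kappa> * ((t - s)\<^sup>2 + (b - t)\<^sup>2)" using \<kappa> by (intro mult_left_mono) auto
    then show ?thesis using e 1 by simp
  qed
  moreover have "g b - \<epsilon> \<le> g t - \<kappa> * m"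
    if *: "\<bar>t\<bar> \<le> K" "\<bar>b\<bar> \<le> K" "r = - 1" "b \<le> t + \<epsilon>" for t b
  proof -
    have "(b - t) * (\<beta> - \<kappa> * (b + t)) \<le> \<epsilon> * (\<beta> - \<kappa> * (b + t))"
      using * slope0[of b t] by (intro mult_right_mono) auto
    also have "\<dots> \<le> \<epsilon> * (1 - 2 * \<kappa>)"
      using * slopeII[of b t] assms(3) by (intro mult_left_mono) auto
    also have "\<dots> = \<epsilon> - \<kappa> * (2 * \<epsilon>)" by (simp add: algebra_simps)
    also have "\<dots> \<le> \<epsilon> - \<kappa> * m" using \<kappa> m by simp
    finally show ?thesis using diff[of b t] by simp
  qed
  moreover have "g s + \<epsilon> \<le> g t - \<kappa> * m"
    if *: "\<bar>s\<bar> \<le> K" "\<bar>t\<bar> \<le> K" "r = 1" "s \<le> t - \<epsilon> + \<kappa> * m" for s t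
  proof -
    have "\<kappa> * m \<le> 1 * m" using \<kappa>1 \<kappa> m by (intro mult_right_mono) auto
    then have neg: "s - t \<le> 0" using *(4) m by linarith
    have "(s - t) * (\<beta> - \<kappa> * (s + t)) \<le> (s - t) * (1 + 2 * \<kappa>)"
      using slopeI[of s t] * neg by (intro mult_left_mono_neg) auto
    also have "\<dots> \<le> (- \<epsilon> + \<kappa> * m) * (1 + 2 * \<kappa>)"
      using *(4) \<kappa> by (intro mult_right_mono) auto
    also have "\<dots> = - \<epsilon> + \<kappa> * (m * (1 + 2 * \<kappa>) - 2 * \<epsilon>)" by (simp add: algebra_simps)
    also have "\<dots> \<le> - \<epsilon> + \<kappa> * (- m)"
    proof -
      have "m * (1 + 2 * \<kappa>) \<le> m * 2" using \<kappa>1 m by (intro mult_left_mono) auto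
      then have "m * (1 + 2 * \<kappa>) - 2 * \<epsilon> \<le> - m" using m by linarith
      then show ?thesis using \<kappa> by (intro add_left_mono mult_left_mono) auto
    qed
    finally show ?thesis using diff[of s t] by simp
  qed
  moreover have "continuous_on UNIV g" unfolding g_def by (intro continuous_intros)
  moreover have "0 < \<kappa> * m" using \<kappa> m by simp
  ultimately show ?thesis using that[of g "\<kappa> * m" "\<kappa> * m"] by blast
qed

text \<open>
  A player who always pulls by \<open>e\<close> makes the token drift out of \<open>\<Omega>\<close>: \<open>\<psi>\<close> is a constant minus an
  exponential so steep that winning the toss outweighs any loss.
\<close>

lemma exit_potential:
  fixes \<Omega> :: "'a::euclidean_space set"
  assumes "bounded \<Omega>" "0 < \<epsilon>" "e \<noteq> 0"
  obtains \<psi> :: "'a \<Rightarrow> real" and \<rho> A :: real where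
    "\<psi> \<in> borel_measurable borel" "1 < \<rho>" "\<And>x. 0 \<le> \<psi> x" "\<And>x. \<psi> x \<le> A" "\<And>x. x \<in> \<Omega> \<Longrightarrow> 1 \<le> \<psi> x"
    "\<And>x y. x \<in> \<Omega> \<Longrightarrow> y \<in> ball x \<epsilon> \<Longrightarrow> x + e \<in> ball x \<epsilon> \<Longrightarrow> \<rho> * ((\<psi> (x + e) + \<psi> y) / 2) \<le> \<psi> x"
proof -
  obtain B where B: "\<And>x. x \<in> \<Omega> \<Longrightarrow> norm x \<le> B" using assms(1) by (auto simp: bounded_iff)
  \<comment> \<open>With \<open>ln 4\<close> a won toss multiplies \<open>E\<close> by 4. Even if a
    lost toss brought \<open>E\<close> down to 0, the mean would be \<open>2 * E x\<close>, a gain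
    of \<open>E x\<close>.\<close>
  define l where "l = ln 4 / (e \<bullet> e)"
  define R where "R = l * ((\<bar>B\<bar> + \<epsilon>) * norm e)"
  define A where "A = 1 + exp R"
  define E where "E x = exp (l * (x \<bullet> e))" for x :: 'a
  \<comment> \<open>The truncation makes \<psi> nonnegative everywhere. Within \<epsilon> of
    \<Omega> the exponential is at most \<open>exp R\<close>, so there the truncation is inactive
    and \<psi> is at least 1.\<close>
  define \<psi> where "\<psi> x = max 0 (A - E x)" for x
  have ee: "0 < e \<bullet> e" using assms(3) by simp
  have l: "0 < l" "l * (e \<bullet> e) = ln 4" unfolding l_def using ee by simp_all
  have E_bounds: "E x \<le> exp R" "exp (- R) \<le> E x" if "norm x \<le> \<bar>B\<bar> + \<epsilon>" for x
  proof -
    have "\<bar>x \<bullet> e\<bar> \<le> norm x * norm e" by (rule Cauchy_Schwarz_ineq2)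
    also have "\<dots> \<le> (\<bar>B\<bar> + \<epsilon>) * norm e" using that by (intro mult_right_mono) auto
    finally have "\<bar>l * (x \<bullet> e)\<bar> \<le> R" unfolding R_def using l by (simp add: abs_mult)
    then show "E x \<le> exp R" "exp (- R) \<le> E x" by (auto simp: E_def)
  qed
  have E_pos: "0 < E x" for x by (simp add: E_def)
  have E_step: "E (x + e) = 4 * E x" for x
    unfolding E_def using l by (simp add: inner_add_left distrib_left exp_add)
  \<comment> \<open>Losing at least \<open>exp (- R)\<close> from a value of at most
    \<open>A\<close> is a decrease at least by the factor \<open>1 / \<rho>\<close>.\<close>
  define \<rho> where "\<rho> = A / (A - exp (- R))"
  have mA: "0 < A - exp (- R)"
  proof -
    have "0 \<le> R" unfolding R_def using l assms(2) by simp
    then have "exp (- R) \<le> 1" by simp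
    then show ?thesis unfolding A_def using exp_gt_zero[of R] by linarith
  qed
  have A: "0 < A" unfolding A_def using exp_gt_zero[of R] by linarith
  have \<rho>: "1 < \<rho>" unfolding \<rho>_def using mA by simp
  have near: "norm y \<le> \<bar>B\<bar> + \<epsilon>" if "x \<in> \<Omega>" "y \<in> ball x \<epsilon>" for x y
  proof -
    have "norm y \<le> norm x + norm (y - x)" using norm_triangle_ineq[of x "y - x"] by simp
    then show ?thesis using B[OF that(1)] that(2) by (simp add: dist_norm norm_minus_commute)
  qed
  have step: "\<rho> * ((\<psi> (x + e) + \<psi> y) / 2) \<le> \<psi> x"
    if x: "x \<in> \<Omega>" and y: "y \<in> ball x \<epsilon>" and xe: "x + e \<in> ball x \<epsilon>" for x y
  proof -
    have "x \<in> ball x \<epsilon>" using assms(2) by simp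
    note nx = near[OF x this]
    have \<psi>: "\<psi> z = A - E z" if "z \<in> ball x \<epsilon>" for z
      using E_bounds(1)[OF near[OF x that]] by (simp add: \<psi>_def A_def)
    have "(\<psi> (x + e) + \<psi> y) / 2 \<le> \<psi> x - E x"
      using \<psi>[OF y] \<psi>[OF xe] \<psi>[OF \<open>x \<in> ball x \<epsilon>\<close>] E_step[of x] E_pos[of y] by simp
    also have "\<dots> \<le> \<psi> x * ((A - exp (- R)) / A)"
    proof -
      have "\<psi> x \<le> A" using \<psi>[OF \<open>x \<in> ball x \<epsilon>\<close>] E_pos[of x] by simp
      then have "\<psi> x * exp (- R) \<le> A * E x"
        using E_bounds(2)[OF nx] A by (intro mult_mono) auto
      then show ?thesis using A by (simp add: field_simps)
    qed
    finally have "(\<psi> (x + e) + \<psi> y) / 2 \<le> \<psi> x / \<rho>" unfolding \<rho>_def by simp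
    then show ?thesis using \<rho> by (simp add: field_simps)
  qed
  have "\<psi> \<in> borel_measurable borel" unfolding \<psi>_def E_def by measurable
  moreover have "1 \<le> \<psi> x" if "x \<in> \<Omega>" for x
    using E_bounds(1)[of x] B[OF that] assms(2) by (simp add: \<psi>_def A_def le_max_iff_disj)
  moreover have "0 \<le> \<psi> x" "\<psi> x \<le> A" for x using E_pos[of x] A by (auto simp: \<psi>_def)
  ultimately show ?thesis using that[of \<psi> \<rho> A] \<rho> step by blast
qed

text \<open>\<open>patching\<close> is applied where \<open>u\<close> varies by at most
  \<open>k\<close> both upwards and downwards. The first alternative describes patched points, the
  second the others, where \<open>u\<close> is steep already and the patch disturbs the extremes
  over the ball only in a controlled way.\<close>

lemma slope_at_least:
  fixes u :: "'a::euclidean_space \<Rightarrow> real"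
  assumes [measurable]: "u \<in> borel_measurable borel" and \<Omega>: "\<Omega> \<in> sets borel" "bounded \<Omega>"
    and u: "\<forall>x. \<bar>u x\<bar> \<le> K" and \<epsilon>: "0 < \<epsilon>" and \<eta>: "0 < \<eta>" and "0 < k\<^sub>0"
  obtains v k where "v \<in> borel_measurable borel" "0 < k" "k \<le> k\<^sub>0"
    "\<And>x. u x \<le> v x" "\<And>x. v x \<le> u x + \<eta>"
    "\<And>x. x \<in> \<Omega> \<Longrightarrow>
      ball_inf \<epsilon> v x = v x - k \<and> ball_sup \<epsilon> v x \<le> v x + k \<and> u x - ball_inf \<epsilon> u x \<le> k \<or>
      v x = u x \<and> (k < ball_sup \<epsilon> u x - u x \<or> k < u x - ball_inf \<epsilon> u x) \<and>
      ball_sup \<epsilon> v x \<le> max (ball_sup \<epsilon> u x) (u x + k) \<and>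
      (ball_inf \<epsilon> u x < u x - k \<longrightarrow> ball_inf \<epsilon> v x = ball_inf \<epsilon> u x)"
proof -
  obtain e :: 'a where "norm e = \<epsilon> / 2" using vector_choose_size[of "\<epsilon> / 2"] \<epsilon> by auto
  then have e: "norm e < \<epsilon>" "e \<noteq> 0" using \<epsilon> by auto
  obtain N :: nat where N: "\<And>x. x \<in> \<Omega> \<Longrightarrow> x + real N *\<^sub>R e \<notin> \<Omega>"
    using bounded_escape[OF \<Omega>(2) e(2)] by blast
  \<comment> \<open>The patch raises \<open>u\<close> by at most \<open>2 * N * k\<close>, which
    this choice keeps below \<eta>.\<close>
  define k where "k = min k\<^sub>0 (\<eta> / (2 * N + 1))"
  have k: "0 < k" "k \<le> k\<^sub>0" using \<open>0 < k\<^sub>0\<close> \<eta> by (auto simp: k_def)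
  have "k \<le> \<eta> / (2 * N + 1)" by (simp add: k_def)
  then have "k * (2 * N + 1) \<le> \<eta>" by (simp add: pos_le_divide_eq)
  then have Nk: "2 * real N * k \<le> \<eta>" using k by (simp add: algebra_simps)
  have [measurable]: "ball_sup \<epsilon> u \<in> borel_measurable borel" "ball_inf \<epsilon> u \<in> borel_measurable borel"
    by (rule borel_measurable_ball_sup[OF u \<epsilon>], rule borel_measurable_ball_inf[OF u \<epsilon>])
  have [measurable]: "\<Omega> \<in> sets borel" by fact
  define V where "V = {x \<in> \<Omega>. ball_sup \<epsilon> u x - u x \<le> k \<and> u x - ball_inf \<epsilon> u x \<le> k}"
  have V_borel: "V \<in> sets borel" unfolding V_def by measurable
  have V_sub: "V \<subseteq> \<Omega>" by (auto simp: V_def)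
  have flat: "\<bar>u y - u x\<bar> \<le> k" if x: "x \<in> V" and y: "y \<in> ball x \<epsilon>" for x y
    using le_ball_sup[OF u y] ball_inf_le[OF u y] x by (auto simp: V_def)
  obtain v where v_meas: "v \<in> borel_measurable borel"
    and out: "\<And>x. x \<notin> V \<Longrightarrow> v x = u x"
    and lower: "\<And>x. u x \<le> v x" and upper: "\<And>x. v x \<le> u x + 2 * real N * k"
    and onV: "\<And>x. x \<in> V \<Longrightarrow> ball_inf \<epsilon> v x = v x - k"
    and lip: "\<And>x y. x \<in> V \<or> y \<in> V \<Longrightarrow> y \<in> ball x \<epsilon> \<Longrightarrow> v y \<le> v x + k"
  proof (rule patching[OF assms(1) V_borel u \<epsilon> _ flat e(1)])
    show "0 \<le> k" using k by simp
    show "x + real N *\<^sub>R e \<notin> V" if "x \<in> V" for x using N[of x] that V_sub by auto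
  qed blast+
  have v: "\<forall>x. \<bar>v x\<bar> \<le> K + \<eta>"
  proof
    fix x show "\<bar>v x\<bar> \<le> K + \<eta>"
      using lower[of x] upper[of x] Nk u[THEN spec, of x] \<eta> by linarith
  qed
  have in_V: "ball_sup \<epsilon> v x \<le> v x + k" if "x \<in> V" for x
    by (rule ball_sup_least[OF \<epsilon>]) (use lip that in auto)
  have sup: "ball_sup \<epsilon> v x \<le> max (ball_sup \<epsilon> u x) (u x + k)" if x: "x \<notin> V" for x
  proof (rule ball_sup_least[OF \<epsilon>])
    fix y assume y: "y \<in> ball x \<epsilon>"
    show "v y \<le> max (ball_sup \<epsilon> u x) (u x + k)"
    proof (cases "y \<in> V")
      case True
      then show ?thesis using lip[OF _ y] out[OF x] by auto
    next
      case False
      then show ?thesis using le_ball_sup[OF u y] out[OF False] by simp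
    qed
  qed
  \<comment> \<open>A point \<open>y\<close> with \<open>u y < u x - k\<close> has \<open>x\<close>
    in its own ball, so \<open>u\<close> varies by more than \<open>k\<close> there and
    \<open>y\<close> is not patched: near-minimizers of \<open>u\<close> survive.\<close>
  have inf: "ball_inf \<epsilon> v x = ball_inf \<epsilon> u x" if less: "ball_inf \<epsilon> u x < u x - k" for x
  proof (rule antisym)
    show "ball_inf \<epsilon> u x \<le> ball_inf \<epsilon> v x" using lower by (intro ball_inf_mono[OF u \<epsilon>]) auto
    show "ball_inf \<epsilon> v x \<le> ball_inf \<epsilon> u x"
    proof (rule field_le_epsilon)
      fix r :: real assume "0 < r"
      then have "ball_inf \<epsilon> u x < min (u x - k) (ball_inf \<epsilon> u x + r)" using less by simp
      then obtain y where y: "y \<in> ball x \<epsilon>" "u y < min (u x - k) (ball_inf \<epsilon> u x + r)"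
        by (rule ball_inf_less[OF u \<epsilon>])
      have "u x \<le> ball_sup \<epsilon> u y" using y(1) by (intro le_ball_sup[OF u]) (simp add: dist_commute)
      then have "y \<notin> V" using y(2) by (auto simp: V_def)
      then have "v y = u y" by (rule out)
      then show "ball_inf \<epsilon> v x \<le> ball_inf \<epsilon> u x + r"
        using ball_inf_le[OF v y(1)] y(2) by simp
    qed
  qed
  show ?thesis
  proof (rule that[OF v_meas k lower])
    show "v x \<le> u x + \<eta>" for x using upper[of x] Nk by linarith
    fix x assume x: "x \<in> \<Omega>"
    show "ball_inf \<epsilon> v x = v x - k \<and> ball_sup \<epsilon> v x \<le> v x + k \<and> u x - ball_inf \<epsilon> u x \<le> k \<or>
      v x = u x \<and> (k < ball_sup \<epsilon> u x - u x \<or> k < u x - ball_inf \<epsilon> u x) \<and>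
      ball_sup \<epsilon> v x \<le> max (ball_sup \<epsilon> u x) (u x + k) \<and>
      (ball_inf \<epsilon> u x < u x - k \<longrightarrow> ball_inf \<epsilon> v x = ball_inf \<epsilon> u x)"
    proof (cases "x \<in> V")
      case True
      then show ?thesis using onV in_V by (auto simp: V_def)
    next
      case False
      then have "k < ball_sup \<epsilon> u x - u x \<or> k < u x - ball_inf \<epsilon> u x" using x by (auto simp: V_def)
      then show ?thesis using sup[OF False] inf[of x] out[OF False] by blast
    qed
  qed
qed

text \<open>\<open>P\<close> is where passing is good: leaving yields no more than the potential,
  and a paid step gains at most its price. At other points of \<Omega> the mean value branch is
  active or the point has been patched, and a move towards the infimum descends. The tolerance
  \<eta> is split equally between patching and bending.\<close>

lemma strict_potential_II:
  fixes u :: "'a::euclidean_space \<Rightarrow> real"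
  assumes [measurable]: "u \<in> borel_measurable borel" and \<Omega>: "open \<Omega>" "bounded \<Omega>"
    and u: "\<forall>x. \<bar>u x\<bar> \<le> K" and \<epsilon>: "0 < \<epsilon>" and \<eta>: "0 < \<eta>"
    and dpp: "\<And>x. x \<in> \<Omega> \<Longrightarrow>
      u x = min ((ball_sup \<epsilon> u x + ball_inf \<epsilon> u x) / 2) (max 0 (ball_sup \<epsilon> u x - \<epsilon>))"
  obtains w :: "'a \<Rightarrow> real" and K' c P s where
    "w \<in> borel_measurable borel" "\<forall>x. \<bar>w x\<bar> \<le> K'" "0 < c"
    "\<And>x. u x \<le> w x" "\<And>x. w x \<le> u x + \<eta>"
    "P \<in> sets borel" "s \<in> borel_measurable borel" "\<And>x. s x \<in> ball x \<epsilon>"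
    "\<And>x. x \<in> P \<Longrightarrow> 0 \<le> w x"
    "\<And>x y. x \<in> P \<Longrightarrow> y \<in> ball x \<epsilon> \<Longrightarrow> w y - \<epsilon> \<le> w x - c"
    "\<And>x y. x \<in> \<Omega> - P \<Longrightarrow> y \<in> ball x \<epsilon> \<Longrightarrow> (w (s x) + w y) / 2 \<le> w x - c"
proof -
  have K: "0 \<le> K" using u[THEN spec, of undefined] by linarith
  have \<eta>2: "0 < \<eta> / 2" using \<eta> by simp
  obtain v k where v_meas: "v \<in> borel_measurable borel" and k: "0 < k" "k \<le> \<epsilon>"
    and lower: "\<And>x. u x \<le> v x" and upper: "\<And>x. v x \<le> u x + \<eta> / 2"
    and v_cases: "\<And>x. x \<in> \<Omega> \<Longrightarrow>
      ball_inf \<epsilon> v x = v x - k \<and> ball_sup \<epsilon> v x \<le> v x + k \<and> u x - ball_inf \<epsilon> u x \<le> k \<or>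
      v x = u x \<and> (k < ball_sup \<epsilon> u x - u x \<or> k < u x - ball_inf \<epsilon> u x) \<and>
      ball_sup \<epsilon> v x \<le> max (ball_sup \<epsilon> u x) (u x + k) \<and>
      (ball_inf \<epsilon> u x < u x - k \<longrightarrow> ball_inf \<epsilon> v x = ball_inf \<epsilon> u x)"
    using slope_at_least[OF assms(1) borel_open[OF \<Omega>(1)] \<Omega>(2) u \<epsilon> \<eta>2, of "\<epsilon>"] \<epsilon> by auto
  define K1 where "K1 = K + \<eta>"
  have K1: "0 \<le> K1" using K \<eta> by (simp add: K1_def)
  have v: "\<forall>x. \<bar>v x\<bar> \<le> K1"
  proof
    fix x show "\<bar>v x\<bar> \<le> K1"
      using lower[of x] upper[of x] u[THEN spec, of x] \<eta> unfolding K1_def by linarith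
  qed
  have super: "0 \<le> v x \<and> ball_sup \<epsilon> v x \<le> v x + \<epsilon> \<or>
      ball_sup \<epsilon> v x + ball_inf \<epsilon> v x \<le> 2 * v x \<and> ball_inf \<epsilon> v x \<le> v x - k" if x: "x \<in> \<Omega>" for x
  proof (rule disjE[OF v_cases[OF x]])
    assume *: "v x = u x \<and> (k < ball_sup \<epsilon> u x - u x \<or> k < u x - ball_inf \<epsilon> u x) \<and>
      ball_sup \<epsilon> v x \<le> max (ball_sup \<epsilon> u x) (u x + k) \<and>
      (ball_inf \<epsilon> u x < u x - k \<longrightarrow> ball_inf \<epsilon> v x = ball_inf \<epsilon> u x)"
    have "2 * u x \<le> ball_sup \<epsilon> u x + ball_inf \<epsilon> u x" using dpp[OF x] by (simp add: min_def split: if_splits)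
    then have up: "k < ball_sup \<epsilon> u x - u x" using * by auto
    then have sup: "ball_sup \<epsilon> v x \<le> ball_sup \<epsilon> u x" using * by auto
    consider "u x = (ball_sup \<epsilon> u x + ball_inf \<epsilon> u x) / 2" | "u x = max 0 (ball_sup \<epsilon> u x - \<epsilon>)"
      using dpp[OF x] by (auto simp: min_def split: if_splits)
    then show ?thesis
    proof cases
      case 1
      then have "2 * u x = ball_sup \<epsilon> u x + ball_inf \<epsilon> u x" by simp
      then show ?thesis using up sup * by auto
    next
      case 2
      then show ?thesis using sup * by auto
    qed
  qed auto
  obtain g :: "real \<Rightarrow> real" and c \<delta> :: real where
    g: "continuous_on UNIV g" "0 < c" "0 < \<delta>"
    and g_near: "\<And>t. \<bar>t\<bar> \<le> K1 \<Longrightarrow> t \<le> g t \<and> g t \<le> t + \<eta> / 2"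
    and g_mean: "\<And>s t b. \<bar>s\<bar> \<le> K1 \<Longrightarrow> \<bar>t\<bar> \<le> K1 \<Longrightarrow> \<bar>b\<bar> \<le> K1 \<Longrightarrow> s \<le> t - k / 2 \<Longrightarrow>
      s + b \<le> 2 * t + \<delta> \<Longrightarrow> (g s + g b) / 2 \<le> g t - c"
    and g_pay: "\<And>t b. \<bar>t\<bar> \<le> K1 \<Longrightarrow> \<bar>b\<bar> \<le> K1 \<Longrightarrow> b \<le> t + \<epsilon> \<Longrightarrow> g b - \<epsilon> \<le> g t - c"
    using concave_bending[OF K1 k(1) \<epsilon>, of "\<eta> / 2" "- 1"] \<eta> by (auto simp: half_gt_zero_iff)
  \<comment> \<open>An error of \<open>\<delta>\<close> is tolerated by \<open>g_mean\<close>, and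
    an error of \<open>k / 2\<close> leaves half of the drop.\<close>
  obtain s where s: "s \<in> borel_measurable borel" "\<And>x. s x \<in> ball x \<epsilon>"
    "\<And>x. v (s x) < ball_inf \<epsilon> v x + min \<delta> (k / 2)"
    using near_infimum_selector[OF v \<epsilon>, of "min \<delta> (k / 2)"] g k by auto
  have [measurable]: "ball_sup \<epsilon> v \<in> borel_measurable borel" by (rule borel_measurable_ball_sup[OF v \<epsilon>])
  have vK: "\<bar>v x\<bar> \<le> K1" for x using v by simp
  define P where "P = {x. 0 \<le> v x \<and> ball_sup \<epsilon> v x \<le> v x + \<epsilon>}"
  show ?thesis
  proof (rule that[of "\<lambda>x. g (v x)" "K1 + \<eta>" c P s])
    show "(\<lambda>x. g (v x)) \<in> borel_measurable borel"
      using borel_measurable_continuous_on[OF g(1) v_meas] .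
    show "P \<in> sets borel" unfolding P_def using v_meas by measurable
    have "\<bar>g (v x)\<bar> \<le> K1 + \<eta>" for x using g_near[OF vK, of x] vK[of x] \<eta> by linarith
    then show "\<forall>x. \<bar>g (v x)\<bar> \<le> K1 + \<eta>" by blast
    show "u x \<le> g (v x)" "g (v x) \<le> u x + \<eta>" for x
      using g_near[OF vK, of x] lower[of x] upper[of x] by linarith+
    show "0 \<le> g (v x)" if "x \<in> P" for x using that g_near[OF vK, of x] by (auto simp: P_def)
    show "g (v y) - \<epsilon> \<le> g (v x) - c" if "x \<in> P" "y \<in> ball x \<epsilon>" for x y
      using that le_ball_sup[OF v, of y x \<epsilon>] by (intro g_pay vK) (auto simp: P_def)
    show "(g (v (s x)) + g (v y)) / 2 \<le> g (v x) - c" if "x \<in> \<Omega> - P" "y \<in> ball x \<epsilon>" for x y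
    proof (rule g_mean[OF vK vK vK])
      have "ball_sup \<epsilon> v x + ball_inf \<epsilon> v x \<le> 2 * v x" "ball_inf \<epsilon> v x \<le> v x - k"
        using super[of x] that by (auto simp: P_def)
      then show "v (s x) \<le> v x - k / 2" "v (s x) + v y \<le> 2 * v x + \<delta>"
        using s(3)[of x] le_ball_sup[OF v that(2)] by linarith+
    qed
  qed (use g s in auto)
qed

text \<open>Intended for the negated solution. The opponent decides here whether the coin is tossed,
  so the toss inequality must hold on all of \<Omega>, while \<open>P\<close> only separates leaving
  from paying.\<close>

lemma strict_potential_I:
  fixes u :: "'a::euclidean_space \<Rightarrow> real"
  assumes [measurable]: "u \<in> borel_measurable borel" and \<Omega>: "open \<Omega>" "bounded \<Omega>"
    and u: "\<forall>x. \<bar>u x\<bar> \<le> K" and \<epsilon>: "0 < \<epsilon>" and \<eta>: "0 < \<eta>"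
    and mean: "\<And>x. x \<in> \<Omega> \<Longrightarrow> ball_sup \<epsilon> u x + ball_inf \<epsilon> u x \<le> 2 * u x"
    and pay: "\<And>x. x \<in> \<Omega> \<Longrightarrow> 0 \<le> u x \<or> ball_inf \<epsilon> u x + \<epsilon> \<le> u x"
  obtains w :: "'a \<Rightarrow> real" and K' c P s where
    "w \<in> borel_measurable borel" "\<forall>x. \<bar>w x\<bar> \<le> K'" "0 < c"
    "\<And>x. u x \<le> w x" "\<And>x. w x \<le> u x + \<eta>"
    "P \<in> sets borel" "s \<in> borel_measurable borel" "\<And>x. s x \<in> ball x \<epsilon>"
    "\<And>x. x \<in> P \<Longrightarrow> 0 \<le> w x"
    "\<And>x. x \<in> \<Omega> - P \<Longrightarrow> w (s x) + \<epsilon> \<le> w x - c"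
    "\<And>x y. x \<in> \<Omega> \<Longrightarrow> y \<in> ball x \<epsilon> \<Longrightarrow> (w (s x) + w y) / 2 \<le> w x - c"
proof -
  have K: "0 \<le> K" using u[THEN spec, of undefined] by linarith
  have \<eta>2: "0 < \<eta> / 2" using \<eta> by simp
  \<comment> \<open>With \<open>k\<close> at most half of \<epsilon>, patched points are too flat
    for the paying alternative in \<open>pay\<close>, so \<open>0 \<le> u x \<le> v x\<close>
    there.\<close>
  obtain v k where v_meas: "v \<in> borel_measurable borel" and k: "0 < k" "k \<le> \<epsilon> / 2"
    and lower: "\<And>x. u x \<le> v x" and upper: "\<And>x. v x \<le> u x + \<eta> / 2"
    and v_cases: "\<And>x. x \<in> \<Omega> \<Longrightarrow>
      ball_inf \<epsilon> v x = v x - k \<and> ball_sup \<epsilon> v x \<le> v x + k \<and> u x - ball_inf \<epsilon> u x \<le> k \<or>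
      v x = u x \<and> (k < ball_sup \<epsilon> u x - u x \<or> k < u x - ball_inf \<epsilon> u x) \<and>
      ball_sup \<epsilon> v x \<le> max (ball_sup \<epsilon> u x) (u x + k) \<and>
      (ball_inf \<epsilon> u x < u x - k \<longrightarrow> ball_inf \<epsilon> v x = ball_inf \<epsilon> u x)"
    using slope_at_least[OF assms(1) borel_open[OF \<Omega>(1)] \<Omega>(2) u \<epsilon> \<eta>2, of "\<epsilon> / 2"] \<epsilon> by auto
  define K1 where "K1 = K + \<eta>"
  have K1: "0 \<le> K1" using K \<eta> by (simp add: K1_def)
  have v: "\<forall>x. \<bar>v x\<bar> \<le> K1"
  proof
    fix x show "\<bar>v x\<bar> \<le> K1"
      using lower[of x] upper[of x] u[THEN spec, of x] \<eta> unfolding K1_def by linarith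
  qed
  have super: "ball_sup \<epsilon> v x + ball_inf \<epsilon> v x \<le> 2 * v x" "ball_inf \<epsilon> v x \<le> v x - k"
    "0 \<le> v x \<or> ball_inf \<epsilon> v x + \<epsilon> \<le> v x" if x: "x \<in> \<Omega>" for x
  proof -
    have "ball_sup \<epsilon> v x + ball_inf \<epsilon> v x \<le> 2 * v x \<and> ball_inf \<epsilon> v x \<le> v x - k \<and>
      (0 \<le> v x \<or> ball_inf \<epsilon> v x + \<epsilon> \<le> v x)"
      using v_cases[OF x] mean[OF x] pay[OF x] lower[of x] k \<epsilon> by auto
    then show "ball_sup \<epsilon> v x + ball_inf \<epsilon> v x \<le> 2 * v x" "ball_inf \<epsilon> v x \<le> v x - k"
      "0 \<le> v x \<or> ball_inf \<epsilon> v x + \<epsilon> \<le> v x" by auto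
  qed
  obtain g :: "real \<Rightarrow> real" and c \<delta> :: real where
    g: "continuous_on UNIV g" "0 < c" "0 < \<delta>"
    and g_near: "\<And>t. \<bar>t\<bar> \<le> K1 \<Longrightarrow> t \<le> g t \<and> g t \<le> t + \<eta> / 2"
    and g_mean: "\<And>s t b. \<bar>s\<bar> \<le> K1 \<Longrightarrow> \<bar>t\<bar> \<le> K1 \<Longrightarrow> \<bar>b\<bar> \<le> K1 \<Longrightarrow> s \<le> t - k / 2 \<Longrightarrow>
      s + b \<le> 2 * t + \<delta> \<Longrightarrow> (g s + g b) / 2 \<le> g t - c"
    and g_pay: "\<And>s t. \<bar>s\<bar> \<le> K1 \<Longrightarrow> \<bar>t\<bar> \<le> K1 \<Longrightarrow> s \<le> t - \<epsilon> + \<delta> \<Longrightarrow> g s + \<epsilon> \<le> g t - c"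
    using concave_bending[OF K1 k(1) \<epsilon>, of "\<eta> / 2" 1] \<eta> by (auto simp: half_gt_zero_iff)
  obtain s where s: "s \<in> borel_measurable borel" "\<And>x. s x \<in> ball x \<epsilon>"
    "\<And>x. v (s x) < ball_inf \<epsilon> v x + min \<delta> (k / 2)"
    using near_infimum_selector[OF v \<epsilon>, of "min \<delta> (k / 2)"] g k by auto
  have vK: "\<bar>v x\<bar> \<le> K1" for x using v by simp
  define P where "P = {x. 0 \<le> v x}"
  show ?thesis
  proof (rule that[of "\<lambda>x. g (v x)" "K1 + \<eta>" c P s])
    show "(\<lambda>x. g (v x)) \<in> borel_measurable borel"
      using borel_measurable_continuous_on[OF g(1) v_meas] .
    show "P \<in> sets borel" unfolding P_def using v_meas by measurable
    have "\<bar>g (v x)\<bar> \<le> K1 + \<eta>" for x using g_near[OF vK, of x] vK[of x] \<eta> by linarith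
    then show "\<forall>x. \<bar>g (v x)\<bar> \<le> K1 + \<eta>" by blast
    show "u x \<le> g (v x)" "g (v x) \<le> u x + \<eta>" for x
      using g_near[OF vK, of x] lower[of x] upper[of x] by linarith+
    show "0 \<le> g (v x)" if "x \<in> P" for x using that g_near[OF vK, of x] by (auto simp: P_def)
    show "g (v (s x)) + \<epsilon> \<le> g (v x) - c" if "x \<in> \<Omega> - P" for x
      using that super(3)[of x] s(3)[of x] by (intro g_pay vK) (auto simp: P_def)
    show "(g (v (s x)) + g (v y)) / 2 \<le> g (v x) - c" if "x \<in> \<Omega>" "y \<in> ball x \<epsilon>" for x y
      using super(1,2)[OF that(1)] s(3)[of x] le_ball_sup[OF v that(2)]
      by (intro g_mean vK) linarith+
  qed (use g s in auto)
qed

section \<open>Strategies\<close>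

text \<open>
  Up to time \<open>T\<close> the strict inequalities for \<open>w\<close> are cashed in as growth in time; from then on, when
  the potential has passed every possible payoff, pulling by \<open>e\<close> makes the game end.
\<close>

lemma two_phase_potential:
  fixes w :: "'a::euclidean_space \<Rightarrow> real" and c :: real
  assumes [measurable]: "w \<in> borel_measurable borel" and w: "\<forall>x. \<bar>w x\<bar> \<le> K'" and c: "0 < c"
    and \<Omega>: "bounded \<Omega>" and \<epsilon>: "0 < \<epsilon>" and M: "0 \<le> M"
  obtains e :: 'a and W :: "nat \<Rightarrow> 'a \<Rightarrow> real" and T :: nat where
    "norm e < \<epsilon>" "\<And>n. W n \<in> borel_measurable borel"
    "\<And>x. W 0 x = w x" "\<And>n x. n < T \<Longrightarrow> W n x = w x + c * n"
    "\<And>n x. n < T \<Longrightarrow> W (Suc n) x \<le> w x + c * Suc n"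
    "\<And>n x. T \<le> n \<Longrightarrow> M \<le> W n x"
    "\<And>n x y. T \<le> n \<Longrightarrow> x \<in> \<Omega> \<Longrightarrow> y \<in> ball x \<epsilon> \<Longrightarrow> (W (Suc n) (x + e) + W (Suc n) y) / 2 \<le> W n x"
    "\<And>n x. - K' \<le> W n x" "\<And>b. \<exists>n. \<forall>x\<in>\<Omega>. b \<le> W n x"
proof -
  obtain e :: 'a where "norm e = \<epsilon> / 2" using vector_choose_size[of "\<epsilon> / 2"] \<epsilon> by auto
  then have e: "norm e < \<epsilon>" "e \<noteq> 0" using \<epsilon> by auto
  obtain \<psi> :: "'a \<Rightarrow> real" and \<rho> A :: real where \<psi>: "\<psi> \<in> borel_measurable borel" "1 < \<rho>" "\<And>x. 0 \<le> \<psi> x" "\<And>x. \<psi> x \<le> A"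
    "\<And>x. x \<in> \<Omega> \<Longrightarrow> 1 \<le> \<psi> x"
    "\<And>x y. x \<in> \<Omega> \<Longrightarrow> y \<in> ball x \<epsilon> \<Longrightarrow> x + e \<in> ball x \<epsilon> \<Longrightarrow> \<rho> * ((\<psi> (x + e) + \<psi> y) / 2) \<le> \<psi> x"
    by (rule exit_potential[OF \<Omega> \<epsilon> e(2)]) (rule that)
  have K': "0 \<le> K'" using w[THEN spec, of undefined] by linarith
  have A: "0 \<le> A" using \<psi>(3,4)[of undefined] by linarith
  obtain T\<^sub>0 :: nat where "M + A + K' < T\<^sub>0 * c" using reals_Archimedean3[OF c] by blast
  \<comment> \<open>At the switch the new potential is at most \<open>M + A\<close>, while
    \<open>w x + c * T\<close> is at least \<open>c * T - K'\<close>; the choice of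
    \<open>T\<^sub>0\<close> makes the passage a decrease. The successor ensures
    \<open>T > 0\<close>, hence \<open>W 0 = w\<close>.\<close>
  define T where "T = Suc T\<^sub>0"
  have T: "M + A + K' \<le> c * T"
    using \<open>M + A + K' < T\<^sub>0 * c\<close> c by (simp add: T_def algebra_simps)
  \<comment> \<open>After \<open>T\<close>, multiplication by \<rho> at each turn uses up the
    decrease of \<psi> in the mean; since \<psi> is at least 1 on \<Omega>, \<open>W\<close> grows
    there without bound.\<close>
  define W where "W n x = (if n < T then w x + c * n else M + \<rho> ^ (n - T) * \<psi> x)" for n x
  have pow: "0 < \<rho> ^ n" for n using \<psi>(2) by simp
  have late: "M \<le> W n x" if "T \<le> n" for n x
    using that \<psi>(3)[of x] pow[of "n - T"] by (simp add: W_def)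
  show ?thesis
  proof (rule that[of e W T])
    show "W n \<in> borel_measurable borel" for n
      unfolding W_def using \<psi>(1) by measurable
    show "W 0 x = w x" for x by (simp add: W_def T_def)
    show "W n x = w x + c * n" if "n < T" for n x using that by (simp add: W_def)
    show "W (Suc n) x \<le> w x + c * Suc n" if "n < T" for n x
    proof (cases "Suc n = T")
      case True
      have "W T x = M + \<psi> x" by (simp add: W_def)
      also have "\<dots> \<le> w x + c * T" using T \<psi>(4)[of x] w[THEN spec, of x] by linarith
      finally show ?thesis unfolding True .
    qed (use that in \<open>simp add: W_def\<close>)
    show "M \<le> W n x" if "T \<le> n" for n x by (rule late[OF that])
    show "(W (Suc n) (x + e) + W (Suc n) y) / 2 \<le> W n x"
      if n: "T \<le> n" and x: "x \<in> \<Omega>" and y: "y \<in> ball x \<epsilon>" for n x y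
    proof -
      have "x + e \<in> ball x \<epsilon>" using e by (simp add: dist_norm)
      from mult_left_mono[OF \<psi>(6)[OF x y this] less_imp_le[OF pow[of "n - T"]]]
      have "\<rho> ^ (n - T) * (\<rho> * ((\<psi> (x + e) + \<psi> y) / 2)) \<le> \<rho> ^ (n - T) * \<psi> x" .
      moreover have "\<rho> ^ (Suc n - T) = \<rho> ^ (n - T) * \<rho>" using n by (simp add: Suc_diff_le)
      ultimately show ?thesis using n by (simp add: W_def algebra_simps)
    qed
    show "- K' \<le> W n x" for n x
    proof (cases "n < T")
      case True
      have "0 \<le> c * n" using c by simp
      with True show ?thesis using w[THEN spec, of x] by (simp add: W_def abs_le_iff minus_le_iff)
    next
      case False
      then show ?thesis using late[of n x] K' M by simp
    qed
    show "\<exists>n. \<forall>x\<in>\<Omega>. b \<le> W n x" for b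
    proof -
      obtain m where m: "b < \<rho> ^ m" using real_arch_pow[OF \<psi>(2)] by blast
      have "b \<le> W (T + m) x" if "x \<in> \<Omega>" for x
      proof -
        have "\<rho> ^ m * 1 \<le> \<rho> ^ m * \<psi> x" using \<psi>(5)[OF that] pow[of m] by (intro mult_left_mono) auto
        then show ?thesis using m M by (simp add: W_def)
      qed
      then show ?thesis by blast
    qed
  qed (rule e(1))
qed

text \<open>The segment from \<open>x\<close> to a point outside \<Omega> meets the frontier, at a
  point no farther from its end than \<open>x\<close> is.\<close>

lemma ball_subset_outer_strip:
  assumes "x \<in> \<Omega>"
  shows "ball x \<epsilon> \<subseteq> \<Omega> \<union> outer_strip \<Omega> \<epsilon>"
proof
  fix y assume y: "y \<in> ball x \<epsilon>"
  show "y \<in> \<Omega> \<union> outer_strip \<Omega> \<epsilon>"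
  proof (cases "y \<in> \<Omega>")
    case False
    have "closed_segment x y \<inter> frontier \<Omega> \<noteq> {}"
      by (rule connected_Int_frontier) (use assms False in auto)
    then obtain z where z: "z \<in> closed_segment x y" "z \<in> frontier \<Omega>" by auto
    have "infdist y (frontier \<Omega>) \<le> dist y z" using z(2) by (rule infdist_le)
    also have "\<dots> \<le> dist x y" using dist_in_closed_segment[OF z(1)] by (simp add: dist_commute)
    finally show ?thesis using y False by (simp add: outer_strip_def)
  qed simp
qed

lemma borel_outer_strip: "open \<Omega> \<Longrightarrow> outer_strip \<Omega> \<epsilon> \<in> sets borel"
proof -
  assume "open \<Omega>"
  then have [measurable]: "\<Omega> \<in> sets borel" by simp
  have [measurable]: "(\<lambda>x. infdist x (frontier \<Omega>)) \<in> borel_measurable borel"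
    by (intro borel_measurable_continuous_onI continuous_intros)
  show ?thesis unfolding outer_strip_def by measurable
qed

section \<open>One strategy for each player, one bound for each value\<close>

context
  fixes \<Omega> :: "'a::euclidean_space set" and \<epsilon> K K' c :: real and F w :: "'a \<Rightarrow> real"
    and P :: "'a set" and s :: "'a \<Rightarrow> 'a" and x\<^sub>0 :: 'a
  assumes \<Omega>: "open \<Omega>" "bounded \<Omega>" and \<epsilon>: "0 < \<epsilon>"
    and F: "(\<lambda>x. if x \<in> outer_strip \<Omega> \<epsilon> then F x else 0) \<in> borel_measurable borel"
    and F_le: "\<And>x. x \<in> outer_strip \<Omega> \<epsilon> \<Longrightarrow> \<bar>F x\<bar> \<le> K" and K: "0 \<le> K"
    and w: "w \<in> borel_measurable borel" "\<forall>x. \<bar>w x\<bar> \<le> K'" and c: "0 < c"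
    and P [measurable]: "P \<in> sets borel"
    and s [measurable]: "s \<in> borel_measurable borel" and s_ball: "\<And>x. s x \<in> ball x \<epsilon>"
    and w_P: "\<And>x. x \<in> P \<Longrightarrow> 0 \<le> w x"
    and x\<^sub>0: "x\<^sub>0 \<in> \<Omega>"
begin

lemma two_phase_strategy:
  assumes "norm e < \<epsilon>" and \<theta>: "\<And>k. {x. \<theta> k x} \<in> sets borel"
  shows "(\<lambda>k h. if k < T then s (h k) else h k + e, \<lambda>k h. \<theta> k (h k)) \<in> strategies \<epsilon>"
proof -
  have "Measurable.pred (histories k) (\<lambda>h. \<theta> k (h k))" for k
    by (rule measurable_compose[of "\<lambda>h. h k" _ borel "\<theta> k"]) (use \<theta> in \<open>simp_all add: pred_def\<close>)
  moreover have "(\<lambda>h. if k < T then s (h k) else h k + e) \<in> borel_measurable (histories k)" for k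
    by measurable
  moreover have "h k + e \<in> ball (h k) \<epsilon>" for h :: "nat \<Rightarrow> 'a" and k
    using assms(1) by (simp add: dist_norm)
  ultimately show ?thesis using s_ball by (auto simp: strategies_def)
qed

text \<open>The drop \<open>c\<close> pays for the growth of \<open>W\<close> by \<open>c\<close>
  per turn up to \<open>T\<close>. From then on Player II never passes, so no payment occurs
  whatever Player I does, and \<open>W\<close> is at least \<open>K\<close>, which dominates
  \<open>F\<close> wherever the token leaves.\<close>

lemma value_II_le:
  assumes F_w: "\<And>x. x \<in> outer_strip \<Omega> \<epsilon> \<Longrightarrow> F x \<le> w x"
    and pass: "\<And>x y. x \<in> P \<Longrightarrow> y \<in> ball x \<epsilon> \<Longrightarrow> w y - \<epsilon> \<le> w x - c"
    and toss: "\<And>x y. x \<in> \<Omega> - P \<Longrightarrow> y \<in> ball x \<epsilon> \<Longrightarrow> (w (s x) + w y) / 2 \<le> w x - c"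
  shows "value_II \<Omega> \<epsilon> F x\<^sub>0 \<le> ereal (w x\<^sub>0)"
proof -
  obtain e :: 'a and W :: "nat \<Rightarrow> 'a \<Rightarrow> real" and T :: nat where e: "norm e < \<epsilon>" and W: "\<And>n. W n \<in> borel_measurable borel"
    "\<And>x. W 0 x = w x" "\<And>n x. n < T \<Longrightarrow> W n x = w x + c * n"
    "\<And>n x. n < T \<Longrightarrow> W (Suc n) x \<le> w x + c * Suc n"
    "\<And>n x. T \<le> n \<Longrightarrow> K \<le> W n x"
    "\<And>n x y. T \<le> n \<Longrightarrow> x \<in> \<Omega> \<Longrightarrow> y \<in> ball x \<epsilon> \<Longrightarrow> (W (Suc n) (x + e) + W (Suc n) y) / 2 \<le> W n x"
    "\<And>n x. - K' \<le> W n x" "\<And>b. \<exists>n. \<forall>x\<in>\<Omega>. b \<le> W n x"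
    by (rule two_phase_potential[OF w c \<Omega>(2) \<epsilon> K]) (rule that)
  define q :: "'a strategy" where
    "q = (\<lambda>k h. if k < T then s (h k) else h k + e, \<lambda>k h. k < T \<and> h k \<in> P)"
  have q: "q \<in> strategies \<epsilon>" unfolding q_def by (rule two_phase_strategy[OF e]) measurable
  have K': "0 \<le> K'" using w(2)[THEN spec, of x\<^sub>0] by linarith
  have cn: "0 \<le> c * real n" for n using c by simp
  have c_Suc: "c * real (Suc n) = c * n + c" for n by (simp add: algebra_simps)
  have play: "potential_play \<Omega> p q \<epsilon> F K T 1 W K' x\<^sub>0" if p: "p \<in> strategies \<epsilon>" for p
  proof (unfold_locales)
    fix n and h :: "nat \<Rightarrow> 'a" assume h: "h \<in> space (histories n)" and in\<Omega>: "h n \<in> \<Omega>"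
    have ph: "fst p n h \<in> ball (h n) \<epsilon>" using p h by (auto simp: strategies_def)
    show "W (Suc n) (fst p n h) - 1 * \<epsilon> \<le> W n (h n)" if "snd q n h" "\<not> snd p n h"
    proof -
      have "n < T" "h n \<in> P" using that by (auto simp: q_def)
      then show ?thesis
        using W(3)[of n "h n"] W(4)[of n "fst p n h"] pass[OF _ ph] c_Suc[of n] by simp
    qed
    show "(W (Suc n) (fst p n h) + W (Suc n) (fst q n h)) / 2 \<le> W n (h n)" if "\<not> snd q n h"
    proof (cases "n < T")
      case True
      then have "h n \<in> \<Omega> - P" "fst q n h = s (h n)" using that in\<Omega> by (auto simp: q_def)
      then show ?thesis
        using True W(3)[of n "h n"] W(4)[of n "fst p n h"] W(4)[of n "s (h n)"] toss[OF _ ph] c_Suc[of n]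
        by simp
    next
      case False
      then have "fst q n h = h n + e" by (simp add: q_def)
      then show ?thesis using W(6)[OF _ in\<Omega> ph, of n] False by (simp add: add.commute)
    qed
    show "0 \<le> W n (h n)" if "snd q n h"
    proof -
      have "n < T" "h n \<in> P" using that by (auto simp: q_def)
      then show ?thesis using W(3)[of n "h n"] w_P[of "h n"] cn[of n] by simp
    qed
  next
    fix n x assume "x \<in> outer_strip \<Omega> \<epsilon>"
    then show "1 * F x \<le> W n x"
      using F_w[of x] F_le[of x] W(3)[of n x] W(5)[of n x] cn[of n] by (cases "n < T") auto
  next
    show "ball x \<epsilon> \<subseteq> \<Omega> \<union> outer_strip \<Omega> \<epsilon>" if "x \<in> \<Omega>" for x
      using that by (rule ball_subset_outer_strip)
  qed (use \<Omega> p q \<epsilon> F F_le K W K' x\<^sub>0 in \<open>auto simp: q_def\<close>)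
  have out: "x\<^sub>0 \<notin> outer_strip \<Omega> \<epsilon>" using x\<^sub>0 by (simp add: outer_strip_def)
  have "(if ends_almost_surely \<Omega> p q x\<^sub>0 then expected_payoff \<Omega> \<epsilon> F p q x\<^sub>0 else \<infinity>) \<le> ereal (w x\<^sub>0)"
    if p: "p \<in> strategies \<epsilon>" for p
  proof -
    obtain m where "expected_payoff \<Omega> \<epsilon> F p q x\<^sub>0 = ereal m" "1 * m \<le> W 0 x\<^sub>0"
      by (rule potential_play.expected_payoff_le[OF play[OF p]])
    then show ?thesis using potential_play.ends[OF play[OF p]] W(2) by simp
  qed
  then show ?thesis
    unfolding value_II_def if_not_P[OF out] by (intro INF_lower2[OF q] SUP_least)
qed

text \<open>The mirror image with \<sigma> = -1: a payment raises the negated payoff, hence the sign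
  of \<epsilon> in \<open>pay\<close>. From \<open>T\<close> on Player I leaves whenever given the
  turn; the payoff 0 is admissible because \<open>W\<close> is then at least
  \<open>K\<close>.\<close>

lemma value_I_ge:
  assumes F_w: "\<And>x. x \<in> outer_strip \<Omega> \<epsilon> \<Longrightarrow> - F x \<le> w x"
    and pay: "\<And>x. x \<in> \<Omega> - P \<Longrightarrow> w (s x) + \<epsilon> \<le> w x - c"
    and toss: "\<And>x y. x \<in> \<Omega> \<Longrightarrow> y \<in> ball x \<epsilon> \<Longrightarrow> (w (s x) + w y) / 2 \<le> w x - c"
  shows "ereal (- w x\<^sub>0) \<le> value_I \<Omega> \<epsilon> F x\<^sub>0"
proof -
  obtain e :: 'a and W :: "nat \<Rightarrow> 'a \<Rightarrow> real" and T :: nat where e: "norm e < \<epsilon>" and W: "\<And>n. W n \<in> borel_measurable borel"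
    "\<And>x. W 0 x = w x" "\<And>n x. n < T \<Longrightarrow> W n x = w x + c * n"
    "\<And>n x. n < T \<Longrightarrow> W (Suc n) x \<le> w x + c * Suc n"
    "\<And>n x. T \<le> n \<Longrightarrow> K \<le> W n x"
    "\<And>n x y. T \<le> n \<Longrightarrow> x \<in> \<Omega> \<Longrightarrow> y \<in> ball x \<epsilon> \<Longrightarrow> (W (Suc n) (x + e) + W (Suc n) y) / 2 \<le> W n x"
    "\<And>n x. - K' \<le> W n x" "\<And>b. \<exists>n. \<forall>x\<in>\<Omega>. b \<le> W n x"
    by (rule two_phase_potential[OF w c \<Omega>(2) \<epsilon> K]) (rule that)
  define p :: "'a strategy" where
    "p = (\<lambda>k h. if k < T then s (h k) else h k + e, \<lambda>k h. k < T \<longrightarrow> h k \<in> P)"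
  have p: "p \<in> strategies \<epsilon>" unfolding p_def by (rule two_phase_strategy[OF e]) measurable
  have K': "0 \<le> K'" using w(2)[THEN spec, of x\<^sub>0] by linarith
  have cn: "0 \<le> c * real n" for n using c by simp
  have c_Suc: "c * real (Suc n) = c * n + c" for n by (simp add: algebra_simps)
  have play: "potential_play \<Omega> p q \<epsilon> F K T (- 1) W K' x\<^sub>0" if q: "q \<in> strategies \<epsilon>" for q
  proof (unfold_locales)
    fix n and h :: "nat \<Rightarrow> 'a" assume h: "h \<in> space (histories n)" and in\<Omega>: "h n \<in> \<Omega>"
    have qh: "fst q n h \<in> ball (h n) \<epsilon>" using q h by (auto simp: strategies_def)
    show "W (Suc n) (fst p n h) - - 1 * \<epsilon> \<le> W n (h n)" if "\<not> snd p n h"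
    proof -
      have "n < T" "h n \<in> \<Omega> - P" "fst p n h = s (h n)" using that in\<Omega> by (auto simp: p_def)
      then show ?thesis
        using W(3)[of n "h n"] W(4)[of n "s (h n)"] pay[of "h n"] c_Suc[of n] by simp
    qed
    show "(W (Suc n) (fst p n h) + W (Suc n) (fst q n h)) / 2 \<le> W n (h n)"
    proof (cases "n < T")
      case True
      then have "fst p n h = s (h n)" by (auto simp: p_def)
      then show ?thesis
        using True W(3)[of n "h n"] W(4)[of n "fst q n h"] W(4)[of n "s (h n)"] toss[OF in\<Omega> qh] c_Suc[of n]
        by simp
    next
      case False
      then have "fst p n h = h n + e" by (simp add: p_def)
      then show ?thesis using W(6)[OF _ in\<Omega> qh, of n] False by simp
    qed
    show "0 \<le> W n (h n)" if "snd p n h"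
    proof (cases "n < T")
      case True
      then have "h n \<in> P" using that by (simp add: p_def)
      then show ?thesis using True W(3)[of n "h n"] w_P[of "h n"] cn[of n] by simp
    qed (use W(5)[of n "h n"] K in simp)
  next
    fix n x assume "x \<in> outer_strip \<Omega> \<epsilon>"
    then show "- 1 * F x \<le> W n x"
      using F_w[of x] F_le[of x] W(3)[of n x] W(5)[of n x] cn[of n] by (cases "n < T") auto
  next
    show "ball x \<epsilon> \<subseteq> \<Omega> \<union> outer_strip \<Omega> \<epsilon>" if "x \<in> \<Omega>" for x
      using that by (rule ball_subset_outer_strip)
  qed (use \<Omega> p q \<epsilon> F F_le K W K' x\<^sub>0 in \<open>auto simp: p_def\<close>)
  have out: "x\<^sub>0 \<notin> outer_strip \<Omega> \<epsilon>" using x\<^sub>0 by (simp add: outer_strip_def)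
  have "ereal (- w x\<^sub>0) \<le> (if ends_almost_surely \<Omega> p q x\<^sub>0 then expected_payoff \<Omega> \<epsilon> F p q x\<^sub>0 else - \<infinity>)"
    if q: "q \<in> strategies \<epsilon>" for q
  proof -
    obtain m where "expected_payoff \<Omega> \<epsilon> F p q x\<^sub>0 = ereal m" "- 1 * m \<le> W 0 x\<^sub>0"
      by (rule potential_play.expected_payoff_le[OF play[OF q]])
    then show ?thesis using potential_play.ends[OF play[OF q]] W(2) by simp
  qed
  then show ?thesis
    unfolding value_I_def if_not_P[OF out] by (intro SUP_upper2[OF p] INF_greatest)
qed

end

text \<open>The usual minimax inequality; the conventions for plays that need not end,
  \<open>- \<infinity>\<close> against \<open>\<infinity>\<close>, respect it.\<close>

lemma value_I_le_value_II: "value_I \<Omega> \<epsilon> F x \<le> value_II \<Omega> \<epsilon> F x"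
proof -
  have "(SUP p\<in>strategies \<epsilon>. INF q\<in>strategies \<epsilon>.
        if ends_almost_surely \<Omega> p q x then expected_payoff \<Omega> \<epsilon> F p q x else - \<infinity>)
    \<le> (INF q\<in>strategies \<epsilon>. SUP p\<in>strategies \<epsilon>.
        if ends_almost_surely \<Omega> p q x then expected_payoff \<Omega> \<epsilon> F p q x else \<infinity>)"
    by (intro SUP_least INF_greatest) (rule SUP_upper2, assumption, rule INF_lower2, assumption, simp)
  then show ?thesis by (simp add: value_I_def value_II_def)
qed

lemma ereal_ball_sup:
  assumes u: "\<forall>y. \<bar>u y\<bar> \<le> K" and \<epsilon>: "0 < \<epsilon>"
  shows "(SUP y\<in>ball x \<epsilon>. ereal (u y)) = ereal (ball_sup \<epsilon> u x)"
  unfolding ball_sup_def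
proof (rule ereal_SUP[symmetric])
  have "(SUP y\<in>ball x \<epsilon>. ereal (u y)) \<le> ereal K"
    using u by (intro SUP_least) (auto simp: abs_le_iff)
  moreover have "ereal (u x) \<le> (SUP y\<in>ball x \<epsilon>. ereal (u y))" using \<epsilon> by (intro SUP_upper) auto
  ultimately show "\<bar>SUP y\<in>ball x \<epsilon>. ereal (u y)\<bar> \<noteq> \<infinity>" by auto
qed

lemma ereal_ball_inf:
  assumes u: "\<forall>y. \<bar>u y\<bar> \<le> K" and \<epsilon>: "0 < \<epsilon>"
  shows "(INF y\<in>ball x \<epsilon>. ereal (u y)) = ereal (ball_inf \<epsilon> u x)"
  unfolding ball_inf_def
proof (rule ereal_INF[symmetric])
  have "ereal (- K) \<le> (INF y\<in>ball x \<epsilon>. ereal (u y))"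
    using u by (intro INF_greatest) (auto simp: abs_le_iff minus_le_iff)
  moreover have "(INF y\<in>ball x \<epsilon>. ereal (u y)) \<le> ereal (u x)" using \<epsilon> by (intro INF_lower) auto
  ultimately show "\<bar>INF y\<in>ball x \<epsilon>. ereal (u y)\<bar> \<noteq> \<infinity>" by auto
qed

theorem theorem6p3:
  fixes \<Omega> :: "'a::euclidean_space set" and \<epsilon> :: real and F :: "'a \<Rightarrow> real"
  assumes "open \<Omega>" and "bounded \<Omega>" and "\<epsilon> > 0"
    and "continuous_on (outer_strip \<Omega> \<epsilon>) F" and "bounded (F ` outer_strip \<Omega> \<epsilon>)"
  shows "\<exists>u :: 'a \<Rightarrow> real.
    (\<forall>x \<in> \<Omega> \<union> outer_strip \<Omega> \<epsilon>.
       value_I \<Omega> \<epsilon> F x = ereal (u x) \<and> value_II \<Omega> \<epsilon> F x = ereal (u x)) \<and>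
    (\<forall>x \<in> \<Omega>. ereal (u x) =
       min (((SUP y\<in>ball x \<epsilon>. ereal (u y)) + (INF y\<in>ball x \<epsilon>. ereal (u y))) / 2)
           (max 0 ((SUP y\<in>ball x \<epsilon>. ereal (u y)) - ereal \<epsilon>))) \<and>
    (\<forall>x \<in> outer_strip \<Omega> \<epsilon>. u x = F x)"
proof -
  note \<Omega> = \<open>open \<Omega>\<close> \<open>bounded \<Omega>\<close> and \<epsilon> = \<open>\<epsilon> > 0\<close>
  \<comment> \<open>The extension by 0 matches the payoff. From \<Omega> one move never leads beyond
    the strip, but the fixed point is sought among functions on the whole space.\<close>
  define f where "f x = (if x \<in> outer_strip \<Omega> \<epsilon> then F x else 0)" for x
  have f_meas: "f \<in> borel_measurable borel"
    unfolding f_def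
    by (intro borel_measurable_continuous_on_if borel_outer_strip \<Omega> assms(4) continuous_on_const)
  obtain K\<^sub>0 where K\<^sub>0: "\<And>x. x \<in> outer_strip \<Omega> \<epsilon> \<Longrightarrow> \<bar>F x\<bar> \<le> K\<^sub>0"
    using assms(5) by (auto simp: bounded_iff)
  define K where "K = max 0 K\<^sub>0"
  have K: "0 \<le> K" and F_le: "\<And>x. x \<in> outer_strip \<Omega> \<epsilon> \<Longrightarrow> \<bar>F x\<bar> \<le> K"
    using K\<^sub>0 by (auto simp: K_def le_max_iff_disj)
  have f_le: "\<forall>x. \<bar>f x\<bar> \<le> K" using F_le K by (simp add: f_def)
  obtain u where u: "u \<in> borel_measurable borel" "\<forall>x. \<bar>u x\<bar> \<le> K" "\<And>x. x \<notin> \<Omega> \<Longrightarrow> u x = f x"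
    and dpp: "\<And>x. x \<in> \<Omega> \<Longrightarrow>
      u x = min ((ball_sup \<epsilon> u x + ball_inf \<epsilon> u x) / 2) (max 0 (ball_sup \<epsilon> u x - \<epsilon>))"
    using dynamic_programming_solution[OF borel_open[OF \<Omega>(1)] f_meas f_le \<epsilon>] by blast
  have u_F: "u x = F x" if "x \<in> outer_strip \<Omega> \<epsilon>" for x
    using that u(3)[of x] by (auto simp: f_def outer_strip_def)
  have F_meas: "(\<lambda>x. if x \<in> outer_strip \<Omega> \<epsilon> then F x else 0) \<in> borel_measurable borel"
    using f_meas unfolding f_def .
  have upper: "value_II \<Omega> \<epsilon> F x \<le> ereal (u x)" if x: "x \<in> \<Omega>" for x
  proof (rule ereal_le_epsilon2)
    fix \<eta> :: real assume \<eta>: "0 < \<eta>"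
    obtain w :: "'a \<Rightarrow> real" and K' c :: real and P and s :: "'a \<Rightarrow> 'a" where w: "w \<in> borel_measurable borel" "\<forall>x. \<bar>w x\<bar> \<le> K'" "0 < c"
      "\<And>x. u x \<le> w x" "\<And>x. w x \<le> u x + \<eta>"
      "P \<in> sets borel" "s \<in> borel_measurable borel" "\<And>x. s x \<in> ball x \<epsilon>"
      "\<And>x. x \<in> P \<Longrightarrow> 0 \<le> w x"
      "\<And>x y. x \<in> P \<Longrightarrow> y \<in> ball x \<epsilon> \<Longrightarrow> w y - \<epsilon> \<le> w x - c"
      "\<And>x y. x \<in> \<Omega> - P \<Longrightarrow> y \<in> ball x \<epsilon> \<Longrightarrow> (w (s x) + w y) / 2 \<le> w x - c"
      by (rule strict_potential_II[OF u(1) \<Omega> u(2) \<epsilon> \<eta> dpp]) (assumption | rule that)+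
    have F_w: "F x \<le> w x" if "x \<in> outer_strip \<Omega> \<epsilon>" for x using u_F[OF that] w(4)[of x] by simp
    have "value_II \<Omega> \<epsilon> F x \<le> ereal (w x)"
      by (rule value_II_le[OF \<Omega> \<epsilon> F_meas F_le K w(1,2,3,6,7,8,9) x F_w w(10,11)])
    also have "\<dots> \<le> ereal (u x) + ereal \<eta>" using w(5)[of x] by simp
    finally show "value_II \<Omega> \<epsilon> F x \<le> ereal (u x) + ereal \<eta>" .
  qed
  have lower: "ereal (u x) \<le> value_I \<Omega> \<epsilon> F x" if x: "x \<in> \<Omega>" for x
  proof (rule ereal_le_epsilon2)
    fix \<eta> :: real assume \<eta>: "0 < \<eta>"
    \<comment> \<open>Negation exchanges suprema and infima. From the minimum in the equation only
      the two upper bounds on \<open>u\<close> are taken, and they become the hypotheses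
      \<open>mean\<close> and \<open>pay\<close>.\<close>
    have minus_u: "(\<lambda>x. - u x) \<in> borel_measurable borel" "\<forall>x. \<bar>- u x\<bar> \<le> K" using u by auto
    have mean: "ball_sup \<epsilon> (\<lambda>x. - u x) x + ball_inf \<epsilon> (\<lambda>x. - u x) x \<le> 2 * (- u x)" if "x \<in> \<Omega>" for x
    proof -
      have "u x \<le> (ball_sup \<epsilon> u x + ball_inf \<epsilon> u x) / 2" unfolding dpp[OF that] by (rule min.cobounded1)
      then have "2 * u x \<le> ball_sup \<epsilon> u x + ball_inf \<epsilon> u x" by simp
      then show ?thesis by (simp add: ball_sup_uminus ball_inf_uminus)
    qed
    have pay: "0 \<le> - u x \<or> ball_inf \<epsilon> (\<lambda>x. - u x) x + \<epsilon> \<le> - u x" if "x \<in> \<Omega>" for x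
    proof -
      have "u x \<le> max 0 (ball_sup \<epsilon> u x - \<epsilon>)" unfolding dpp[OF that] by (rule min.cobounded2)
      then show ?thesis by (auto simp: ball_inf_uminus le_max_iff_disj)
    qed
    obtain w :: "'a \<Rightarrow> real" and K' c :: real and P and s :: "'a \<Rightarrow> 'a" where w: "w \<in> borel_measurable borel" "\<forall>x. \<bar>w x\<bar> \<le> K'" "0 < c"
      "\<And>x. - u x \<le> w x" "\<And>x. w x \<le> - u x + \<eta>"
      "P \<in> sets borel" "s \<in> borel_measurable borel" "\<And>x. s x \<in> ball x \<epsilon>"
      "\<And>x. x \<in> P \<Longrightarrow> 0 \<le> w x"
      "\<And>x. x \<in> \<Omega> - P \<Longrightarrow> w (s x) + \<epsilon> \<le> w x - c"
      "\<And>x y. x \<in> \<Omega> \<Longrightarrow> y \<in> ball x \<epsilon> \<Longrightarrow> (w (s x) + w y) / 2 \<le> w x - c"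
      by (rule strict_potential_I[OF minus_u(1) \<Omega> minus_u(2) \<epsilon> \<eta> mean pay]) (assumption | rule that)+
    have F_w: "- F x \<le> w x" if "x \<in> outer_strip \<Omega> \<epsilon>" for x using u_F[OF that] w(4)[of x] by simp
    have "ereal (- w x) \<le> value_I \<Omega> \<epsilon> F x"
      by (rule value_I_ge[OF \<Omega> \<epsilon> F_meas F_le K w(1,2,3,6,7,8,9) x F_w w(10,11)])
    then have "ereal (- w x) + ereal \<eta> \<le> value_I \<Omega> \<epsilon> F x + ereal \<eta>" by (rule add_right_mono)
    moreover have "ereal (u x) \<le> ereal (- w x) + ereal \<eta>" using w(5)[of x] by simp
    ultimately show "ereal (u x) \<le> value_I \<Omega> \<epsilon> F x + ereal \<eta>" by (rule order_trans[rotated])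
  qed
  have "value_I \<Omega> \<epsilon> F x = ereal (u x) \<and> value_II \<Omega> \<epsilon> F x = ereal (u x)"
    if "x \<in> \<Omega> \<union> outer_strip \<Omega> \<epsilon>" for x
  proof (cases "x \<in> \<Omega>")
    case True
    then show ?thesis
      using upper[OF True] lower[OF True] value_I_le_value_II[of \<Omega> \<epsilon> F x] by (intro conjI; order)
  next
    case False
    then show ?thesis using that u_F[of x] by (simp add: value_I_def value_II_def)
  qed
  moreover have "ereal (u x) =
       min (((SUP y\<in>ball x \<epsilon>. ereal (u y)) + (INF y\<in>ball x \<epsilon>. ereal (u y))) / 2)
           (max 0 ((SUP y\<in>ball x \<epsilon>. ereal (u y)) - ereal \<epsilon>))" if "x \<in> \<Omega>" for x
  proof -
    have "min (((SUP y\<in>ball x \<epsilon>. ereal (u y)) + (INF y\<in>ball x \<epsilon>. ereal (u y))) / 2)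
           (max 0 ((SUP y\<in>ball x \<epsilon>. ereal (u y)) - ereal \<epsilon>))
      = ereal (min ((ball_sup \<epsilon> u x + ball_inf \<epsilon> u x) / 2) (max 0 (ball_sup \<epsilon> u x - \<epsilon>)))"
      unfolding ereal_ball_sup[OF u(2) \<epsilon>] ereal_ball_inf[OF u(2) \<epsilon>]
      by (simp add: zero_ereal_def)
    then show ?thesis using dpp[OF that] by simp
  qed
  ultimately show ?thesis using u_F by blast
qed

end
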